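(* Let $m$ be a natural number ($m\ge 1$) or $m=\infty$, and let $\underline{A}_m=\{\underline{A}_m(n)\}_{n\ge1}$ be the non-$\Sigma$ operad for $A(m)$-algebras. For each $n\ge 1$, the admissible $n$-trees form a linear basis of $\underline{A}_m(n)$, that is, $$\underline{A}_m(n)\cong \mathrm{Span}_{\mathbf k}(\mathrm{Adm}_m(n)),$$ where the isomorphism sends an admissible tree to its class in $\underline{A}_m(n)$.
   Context: $\mathbf k$ is a field of characteristic zero. Trees. An $n$-tree is a finite connected acyclic directed (rooted) tree with one output leg (the root) and $n$ input legs; legs are half-edges attached to only one vertex. Every edge points towards the root; the input edges of a vertex $v$ are those pointing towards $v$, and $\mathrm{val}(v)$ denotes their number (the arity of $v$), which is at least $1$. Arity-one vertices are called unary. The trivial $1$-tree consisting of one edge (both root and input leg) and no vertices is allowed. A planar tree is a tree with an isotopy class of embedding in the plane, i.e. with a linear order on the input edges of each vertex. $T_m(n)$ denotes the set of planar $n$-trees all of whose vertices have arity at most $m$ (unary vertices allowed). The degree is $\deg(T)=\sum_{v}(\mathrm{val}(v)-2)$, summed over all vertices $v$ of $T$. An input vertex is a vertex all of whose input edges are input legs of the tree. A tree $T\in T_m(n)$ is admissible if all its unary vertices are input vertices of $T$; $\mathrm{Adm}_m(n)\subset T_m(n)$ is the set of admissible trees. Operad. Let $\underline{F}_m$ be the free graded non-$\Sigma$ operad (in graded $\mathbf k$-vector spaces, with Koszul signs) generated by operations $\xi_i$, $1\le i\le m$, $i<\infty$, where $\xi_i$ has arity $i$ and degree $i-2$. Then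 $\underline{F}_m(n)=\mathrm{Span}_{\mathbf k}(T_m(n))$: the $j$-corolla (the $j$-tree with one vertex) is $\xi_j$, the trivial tree is the operad unit, a tree with root corolla $\xi_k$ and subtrees $S_1,\dots,S_k$ attached to its inputs corresponds to the operadic composite $\xi_k(S_1,\dots,S_k)$, and the operad structure is given by grafting (up to the resulting Koszul signs). The circle product $f\circ_i g$ denotes insertion of $g$ in the $i$-th input of $f$. Define $\underline{A}_m:=\underline{F}_m/\underline{I}_m$, where $\underline{I}_m$ is the operadic ideal generated by $$\Phi_n:=\sum_{\lambda=0}^{n-1}\sum_{k=1}^{n-\lambda}(-1)^{\lambda(k+1)+k}\,\xi_{n-k+1}\circ_{\lambda+1}\xi_k\in\underline{F}_m(n),\qquad 1\le n\le m,\ n<\infty.$$ *)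

theory Defs
  imports
    "HOL-Library.Poly_Mapping"
    "HOL-Library.Extended_Nat"
    "HOL-Algebra.AbelCoset"
    "Jordan_Normal_Form.VS_Connect"
begin

section \<open>Planar rooted trees\<close>

text \<open>
  A value of type \<open>ptree\<close> is a planar rooted tree up to isotopy. \<open>Leg\<close> is the trivial tree, a single
  edge without vertices, which is both the root and an input leg. \<open>Vertex ts\<close> has a root vertex whose
  input edges, in their linear order, are the roots of the trees \<open>ts\<close>; if such a tree is \<open>Leg\<close>, then
  the input edge is an input leg of the whole tree. The datatype also contains vertices without
  inputs, which are excluded in \<open>ntrees\<close>.
\<close>

datatype ptree = Leg | Vertex "ptree list"

fun legs :: "ptree \<Rightarrow> nat" where
  "legs Leg = 1"
| "legs (Vertex ts) = (\<Sum>t\<leftarrow>ts. legs t)"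

text \<open>
  The vertices of a tree, in depth-first order from the root and from left to right. A vertex is
  recorded by the list of the subtrees attached to its input edges, so its arity is the length of
  that list. Equal entries may occur at different positions, hence a list and not a set.
\<close>

fun vertices :: "ptree \<Rightarrow> ptree list list" where
  "vertices Leg = []"
| "vertices (Vertex ts) = ts # concat (map vertices ts)"

definition deg :: "ptree \<Rightarrow> int" where
  "deg t = (\<Sum>v\<leftarrow>vertices t. int (length v) - 2)"

definition ntrees :: "enat \<Rightarrow> nat \<Rightarrow> ptree set" where
  "ntrees m n = {t. legs t = n \<and> (\<forall>v\<in>set (vertices t). 1 \<le> length v \<and> enat (length v) \<le> m)}"

definition input_vertex :: "ptree list \<Rightarrow> bool" where
  "input_vertex v \<longleftrightarrow> (\<forall>t\<in>set v. t = Leg)"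

definition admissible :: "ptree \<Rightarrow> bool" where
  "admissible t \<longleftrightarrow> (\<forall>v\<in>set (vertices t). length v = 1 \<longrightarrow> input_vertex v)"

definition Adm :: "enat \<Rightarrow> nat \<Rightarrow> ptree set" where
  "Adm m n = {t \<in> ntrees m n. admissible t}"


section \<open>Grafting\<close>

text \<open>\<open>graft t i s\<close> inserts the root of \<open>s\<close> into the \<open>i\<close>-th input leg of \<open>t\<close>, for \<open>1 \<le> i \<le> legs t\<close>.\<close>

fun graft :: "ptree \<Rightarrow> nat \<Rightarrow> ptree \<Rightarrow> ptree"
  and graft_forest :: "ptree list \<Rightarrow> nat \<Rightarrow> ptree \<Rightarrow> ptree list" where
  "graft Leg i s = s"
| "graft (Vertex ts) i s = Vertex (graft_forest ts i s)"
| "graft_forest [] i s = []"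
| "graft_forest (t # ts) i s =
     (if i \<le> legs t then graft t i s # ts else t # graft_forest ts (i - legs t) s)"

text \<open>
  The sign of a graft. As an operadic composite, a tree stands for the product of its vertices in
  depth-first order: \<open>\<xi>\<^sub>k(S\<^sub>1, \<dots>, S\<^sub>k)\<close> is \<open>\<xi>\<^sub>k\<close> followed by \<open>S\<^sub>1\<close>, then \<open>S\<^sub>2\<close>, and so on, as for
  \<open>\<xi>\<^sub>k \<circ> (S\<^sub>1 \<otimes> \<dots> \<otimes> S\<^sub>k)\<close> with the Koszul rule \<open>(f \<otimes> g)(a \<otimes> b) = (-1)\<^bsup>|g||a|\<^esup> f a \<otimes> g b\<close>. To
  insert \<open>s\<close> into the \<open>i\<close>-th leg of \<open>t\<close>, one moves \<open>s\<close> leftwards past the vertices of \<open>t\<close> that come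
  after that leg; \<open>deg_after t i\<close> is the sum of the degrees of these vertices.
\<close>

fun deg_after :: "ptree \<Rightarrow> nat \<Rightarrow> int"
  and deg_after_forest :: "ptree list \<Rightarrow> nat \<Rightarrow> int" where
  "deg_after Leg i = 0"
| "deg_after (Vertex ts) i = deg_after_forest ts i"
| "deg_after_forest [] i = 0"
| "deg_after_forest (t # ts) i =
     (if i \<le> legs t then deg_after t i + (\<Sum>u\<leftarrow>ts. deg u) else deg_after_forest ts (i - legs t))"

definition koszul :: "ptree \<Rightarrow> nat \<Rightarrow> ptree \<Rightarrow> 'k::comm_ring_1" where
  "koszul t i s = (if even (deg s * deg_after t i) then 1 else -1)"


section \<open>The free operad\<close>

text \<open>
  Linear combinations of trees are finitely supported functions \<open>ptree \<Rightarrow>\<^sub>0 'k\<close>. \<open>tree_space S\<close> is the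
  vector space with basis \<open>S\<close>. The fields \<open>mult\<close> and \<open>one\<close> of a module record play no role.
\<close>

definition tree_space :: "ptree set \<Rightarrow> ('k::field, ptree \<Rightarrow>\<^sub>0 'k) module" where
  "tree_space S = \<lparr>carrier = {f. Poly_Mapping.keys f \<subseteq> S}, mult = undefined, one = undefined,
     zero = 0, add = (+), smult = (\<lambda>c. Poly_Mapping.map ((*) c))\<rparr>"

abbreviation tree :: "ptree \<Rightarrow> ptree \<Rightarrow>\<^sub>0 'k::field" where
  "tree t \<equiv> Poly_Mapping.single t 1"

definition free_operad :: "enat \<Rightarrow> nat \<Rightarrow> ('k::field, ptree \<Rightarrow>\<^sub>0 'k) module" where
  "free_operad m n = tree_space (ntrees m n)"

definition circ :: "(ptree \<Rightarrow>\<^sub>0 'k) \<Rightarrow> nat \<Rightarrow> (ptree \<Rightarrow>\<^sub>0 'k) \<Rightarrow> ptree \<Rightarrow>\<^sub>0 'k::field" where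
  "circ f i g = (\<Sum>t\<in>Poly_Mapping.keys f. \<Sum>s\<in>Poly_Mapping.keys g.
     Poly_Mapping.single (graft t i s)
       (koszul t i s * Poly_Mapping.lookup f t * Poly_Mapping.lookup g s))"

definition xi :: "nat \<Rightarrow> ptree \<Rightarrow>\<^sub>0 'k::field" where
  "xi j = tree (Vertex (replicate j Leg))"


section \<open>The operad for \<open>A(m)\<close>-algebras\<close>

definition Phi :: "nat \<Rightarrow> ptree \<Rightarrow>\<^sub>0 'k::field" where
  "Phi n = (\<Sum>l = 0..n - 1. \<Sum>k = 1..n - l.
     Poly_Mapping.map ((*) ((-1) ^ (l * (k + 1) + k))) (circ (xi (n - k + 1)) (l + 1) (xi k)))"

text \<open>
  Homogeneity of ideals is not required: the elements \<open>Phi n\<close> are homogeneous of degree \<open>n - 3\<close>, and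
  \<open>circ\<close> is bilinear and additive on degrees, so the smallest ideal containing them is graded.
\<close>

definition operadic_ideal :: "enat \<Rightarrow> (nat \<Rightarrow> (ptree \<Rightarrow>\<^sub>0 'k::field) set) \<Rightarrow> bool" where
  "operadic_ideal m J \<longleftrightarrow>
     (\<forall>n\<ge>1. subspace class_ring (J n) (free_operad m n)) \<and>
     (\<forall>n\<ge>1. \<forall>n'\<ge>1. \<forall>i\<in>{1..n}. \<forall>f\<in>carrier (free_operad m n). \<forall>g\<in>carrier (free_operad m n').
        f \<in> J n \<or> g \<in> J n' \<longrightarrow> circ f i g \<in> J (n + n' - 1))"

definition A_ideal :: "enat \<Rightarrow> nat \<Rightarrow> (ptree \<Rightarrow>\<^sub>0 'k::field) set" where
  "A_ideal m n =
     \<Inter> {J n | J. operadic_ideal m J \<and> (\<forall>k. 1 \<le> k \<and> enat k \<le> m \<longrightarrow> Phi k \<in> J k)}"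

text \<open>
  The elements of the quotient are the cosets of \<open>N\<close>. Adding \<open>N\<close> in \<open>smult\<close> makes zero times a coset
  equal to \<open>N\<close>, and not only to the set consisting of the zero vector.
\<close>

definition quotient_module :: "('k, 'v) module \<Rightarrow> 'v set \<Rightarrow> ('k, 'v set) module" where
  "quotient_module M N = \<lparr>carrier = a_rcosets\<^bsub>M\<^esub> N, mult = undefined, one = undefined,
     zero = N, add = set_add M, smult = (\<lambda>c X. \<Union>x\<in>X. N +>\<^bsub>M\<^esub> (c \<odot>\<^bsub>M\<^esub> x))\<rparr>"

definition A_operad :: "enat \<Rightarrow> nat \<Rightarrow> ('k::field, (ptree \<Rightarrow>\<^sub>0 'k) set) module" where
  "A_operad m n = quotient_module (free_operad m n) (A_ideal m n)"

definition A_class :: "enat \<Rightarrow> nat \<Rightarrow> ptree \<Rightarrow> (ptree \<Rightarrow>\<^sub>0 'k::field) set" where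
  "A_class m n t = A_ideal m n +>\<^bsub>free_operad m n\<^esub> tree t"


section \<open>Consistency of the conventions\<close>

text \<open>
  The trees with \<open>circ\<close> satisfy the axioms of a graded non-symmetric operad with unit \<open>Leg\<close>, and
  attaching subtrees to a corolla from left to right produces no sign.
\<close>

lemma deg_Leg [simp]: "deg Leg = 0"
  by (simp add: deg_def)

lemma deg_Vertex: "deg (Vertex ts) = int (length ts) - 2 + (\<Sum>t\<leftarrow>ts. deg t)"
proof -
  have "(\<Sum>v\<leftarrow>concat (map vertices us). int (length v) - 2) = (\<Sum>t\<leftarrow>us. deg t)" for us
    by (induction us) (simp_all add: deg_def)
  then show ?thesis by (simp add: deg_def)
qed

lemma length_graft_forest [simp]: "length (graft_forest ts i s) = length ts"
  by (induction ts arbitrary: i) auto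

lemma legs_graft:
  "\<lbrakk>1 \<le> i; i \<le> legs t\<rbrakk> \<Longrightarrow> legs (graft t i s) + 1 = legs t + legs s"
  "\<lbrakk>1 \<le> i; i \<le> (\<Sum>t\<leftarrow>ts. legs t)\<rbrakk> \<Longrightarrow>
     (\<Sum>t\<leftarrow>graft_forest ts i s. legs t) + 1 = (\<Sum>t\<leftarrow>ts. legs t) + legs s"
  by (induction t i s and ts i s rule: graft_graft_forest.induct) auto

lemma deg_graft:
  "\<lbrakk>1 \<le> i; i \<le> legs t\<rbrakk> \<Longrightarrow> deg (graft t i s) = deg t + deg s"
  "\<lbrakk>1 \<le> i; i \<le> (\<Sum>t\<leftarrow>ts. legs t)\<rbrakk> \<Longrightarrow>
     (\<Sum>t\<leftarrow>graft_forest ts i s. deg t) = (\<Sum>t\<leftarrow>ts. deg t) + deg s"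
  by (induction t i s and ts i s rule: graft_graft_forest.induct) (auto simp: deg_Vertex)

lemma vertices_graft:
  "v \<in> set (vertices (graft t i s)) \<Longrightarrow>
     \<exists>w\<in>set (vertices t) \<union> set (vertices s). length v = length w"
  "u \<in> set (graft_forest ts i s) \<Longrightarrow> v \<in> set (vertices u) \<Longrightarrow>
     \<exists>w\<in>(\<Union>t\<in>set ts. set (vertices t)) \<union> set (vertices s). length v = length w"
proof (induction t i s and ts i s arbitrary: v and u v rule: graft_graft_forest.induct)
  case (2 ts i s)
  then show ?case by fastforce
next
  case (4 t ts i s)
  then show ?case by (fastforce split: if_splits)
qed auto

lemma graft_in_ntrees:
  assumes "t \<in> ntrees m n" "s \<in> ntrees m n'" "1 \<le> i" "i \<le> n"
  shows "graft t i s \<in> ntrees m (n + n' - 1)"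
proof -
  have "legs (graft t i s) + 1 = n + n'"
    using assms legs_graft(1)[of i t s] by (auto simp: ntrees_def)
  moreover have "1 \<le> length v \<and> enat (length v) \<le> m" if "v \<in> set (vertices (graft t i s))" for v
    using vertices_graft(1)[OF that] assms by (auto simp: ntrees_def)
  ultimately show ?thesis by (auto simp: ntrees_def)
qed

lemma graft_sequential:
  "\<lbrakk>1 \<le> i; i \<le> legs t; 1 \<le> j; j \<le> legs s\<rbrakk> \<Longrightarrow>
     graft (graft t i s) (i + j - 1) u = graft t i (graft s j u) \<and>
     deg_after (graft t i s) (i + j - 1) = deg_after t i + deg_after s j"
  "\<lbrakk>1 \<le> i; i \<le> (\<Sum>t\<leftarrow>ts. legs t); 1 \<le> j; j \<le> legs s\<rbrakk> \<Longrightarrow>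
     graft_forest (graft_forest ts i s) (i + j - 1) u = graft_forest ts i (graft s j u) \<and>
     deg_after_forest (graft_forest ts i s) (i + j - 1) = deg_after_forest ts i + deg_after s j"
proof (induction t i s and ts i s rule: graft_graft_forest.induct)
  case (4 t ts i s)
  show ?case
  proof (cases "i \<le> legs t")
    case True
    then show ?thesis using 4 legs_graft(1)[of i t s] by auto
  next
    case False
    then have "i + j - 1 - legs t = i - legs t + j - 1" "\<not> i + j - 1 \<le> legs t"
      using 4 by auto
    then show ?thesis using False 4 by auto
  qed
qed auto

lemma graft_parallel:
  "\<lbrakk>1 \<le> i; i < k; k \<le> legs t\<rbrakk> \<Longrightarrow>
     graft (graft t i s) (k + legs s - 1) u = graft (graft t k u) i s \<and>
     deg_after (graft t i s) (k + legs s - 1) = deg_after t k \<and>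
     deg_after (graft t k u) i = deg_after t i + deg u"
  "\<lbrakk>1 \<le> i; i < k; k \<le> (\<Sum>t\<leftarrow>ts. legs t)\<rbrakk> \<Longrightarrow>
     graft_forest (graft_forest ts i s) (k + legs s - 1) u
       = graft_forest (graft_forest ts k u) i s \<and>
     deg_after_forest (graft_forest ts i s) (k + legs s - 1) = deg_after_forest ts k \<and>
     deg_after_forest (graft_forest ts k u) i = deg_after_forest ts i + deg u"
proof (induction t i s and ts i s arbitrary: k and k rule: graft_graft_forest.induct)
  case (4 t ts i s)
  consider "k \<le> legs t" | "i \<le> legs t" "legs t < k" | "legs t < i" by linarith
  then show ?case
  proof cases
    case 1
    then show ?thesis using 4 legs_graft(1)[of i t s] legs_graft(1)[of k t u] by auto
  next
    case 2
    have "k + legs s - 1 - legs (graft t i s) = k - legs t" "\<not> k + legs s - 1 \<le> legs (graft t i s)"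
      using 2 4 legs_graft(1)[of i t s] by auto
    then show ?thesis using 2 4 deg_graft(2)[of "k - legs t" ts u] by auto
  next
    case 3
    then have "k + legs s - Suc (legs t) = k - legs t + legs s - 1" "\<not> k + legs s - 1 \<le> legs t"
      using 4 by auto
    then show ?thesis using 3 4 "4.IH"(2)[of "k - legs t"] by auto
  qed
qed auto

lemma circ_single:
  "circ (Poly_Mapping.single t a) i (Poly_Mapping.single s b)
     = Poly_Mapping.single (graft t i s) (koszul t i s * a * b)"
  by (cases "a = 0"; cases "b = 0") (simp_all add: circ_def)

lemma circ_unit:
  "circ (tree Leg) 1 (tree t) = (tree t :: ptree \<Rightarrow>\<^sub>0 'k::field)"
  "\<lbrakk>1 \<le> i; i \<le> legs t\<rbrakk> \<Longrightarrow> circ (tree t) i (tree Leg) = (tree t :: ptree \<Rightarrow>\<^sub>0 'k::field)"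
proof -
  have "1 \<le> i \<Longrightarrow> i \<le> legs t \<Longrightarrow> graft t i Leg = t"
    and "1 \<le> i \<Longrightarrow> i \<le> (\<Sum>t\<leftarrow>ts. legs t) \<Longrightarrow> graft_forest ts i Leg = ts" for ts
    by (induction t i Leg and ts i Leg rule: graft_graft_forest.induct) auto
  then show "\<lbrakk>1 \<le> i; i \<le> legs t\<rbrakk> \<Longrightarrow> circ (tree t) i (tree Leg) = (tree t :: ptree \<Rightarrow>\<^sub>0 'k)"
    by (simp add: circ_single koszul_def)
qed (simp add: circ_single koszul_def)

lemma circ_sequential:
  assumes "1 \<le> i" "i \<le> legs t" "1 \<le> j" "j \<le> legs s"
  shows "circ (circ (tree t) i (tree s)) (i + j - 1) (tree u)
       = (circ (tree t) i (circ (tree s) j (tree u)) :: ptree \<Rightarrow>\<^sub>0 'k::field)"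
  using graft_sequential(1)[OF assms, of u] deg_graft(1)[of j s u] assms
  by (auto simp: circ_single koszul_def)

lemma circ_parallel:
  assumes "1 \<le> i" "i < k" "k \<le> legs t"
  shows "circ (circ (tree t) i (tree s)) (k + legs s - 1) (tree u)
       = Poly_Mapping.map ((*) (if even (deg s * deg u) then 1 else -1))
           (circ (circ (tree t) k (tree u)) i (tree s) :: ptree \<Rightarrow>\<^sub>0 'k::field)"
  using graft_parallel(1)[OF assms, of s u]
  by (auto simp: circ_single koszul_def)

lemma circ_attach_subtree:
  assumes "\<forall>t\<in>set ls. t = Leg"
  shows "circ (tree (Vertex (ss @ Leg # ls))) ((\<Sum>t\<leftarrow>ss. legs t) + 1) (tree s)
       = (tree (Vertex (ss @ s # ls)) :: ptree \<Rightarrow>\<^sub>0 'k::field)"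
proof -
  have deg_ls: "(\<Sum>t\<leftarrow>ls. deg t) = 0" using assms by (induction ls) auto
  have "graft_forest (ss @ Leg # ls) ((\<Sum>t\<leftarrow>ss. legs t) + 1) s = ss @ s # ls
      \<and> deg_after_forest (ss @ Leg # ls) ((\<Sum>t\<leftarrow>ss. legs t) + 1) = 0"
    using deg_ls by (induction ss) auto
  then show ?thesis by (simp add: circ_single koszul_def)
qed

lemma lookup_map_scale:
  "Poly_Mapping.lookup (Poly_Mapping.map ((*) c) f) t = c * Poly_Mapping.lookup f t"
  for c :: "'k::field"
  by (simp add: Poly_Mapping.map.rep_eq when_def)

lemma vectorspace_tree_space:
  "vectorspace class_ring (tree_space S :: ('k::field, ptree \<Rightarrow>\<^sub>0 'k) module)"
proof (rule vs_criteria)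
  let ?V = "tree_space S :: ('k, ptree \<Rightarrow>\<^sub>0 'k) module"
  have keys_scale: "Poly_Mapping.keys (Poly_Mapping.map ((*) c) f) \<subseteq> Poly_Mapping.keys f"
    for c :: 'k and f :: "ptree \<Rightarrow>\<^sub>0 'k"
    by (auto simp: in_keys_iff lookup_map_scale)
  show "\<forall>v\<in>carrier ?V. \<exists>w\<in>carrier ?V. v \<oplus>\<^bsub>?V\<^esub> w = \<zero>\<^bsub>?V\<^esub>"
  proof
    fix v assume "v \<in> carrier ?V"
    then have "- v \<in> carrier ?V" by (simp add: tree_space_def)
    moreover have "v \<oplus>\<^bsub>?V\<^esub> (- v) = \<zero>\<^bsub>?V\<^esub>" by (simp add: tree_space_def)
    ultimately show "\<exists>w\<in>carrier ?V. v \<oplus>\<^bsub>?V\<^esub> w = \<zero>\<^bsub>?V\<^esub>" by blast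
  qed
  show "\<forall>v w. v \<in> carrier ?V \<and> w \<in> carrier ?V \<longrightarrow> v \<oplus>\<^bsub>?V\<^esub> w \<in> carrier ?V"
    using Poly_Mapping.keys_add by (fastforce simp: tree_space_def)
  show "\<forall>c v. c \<in> carrier class_ring \<and> v \<in> carrier ?V \<longrightarrow> c \<odot>\<^bsub>?V\<^esub> v \<in> carrier ?V"
    using keys_scale by (fastforce simp: tree_space_def)
qed (auto simp: tree_space_def class_field add_ac algebra_simps lookup_add
       lookup_map_scale intro!: poly_mapping_eqI)

end

theory Submission
  imports Defs
begin

text \<open>
  The relation \<open>\<Phi>\<^sub>n = 0\<close> expresses \<open>\<xi>\<^sub>1 \<circ> \<xi>\<^sub>n\<close> through trees in which \<open>\<xi>\<^sub>1\<close> sits higher up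
  or does not occur. Used as a rewrite rule, it moves every unary vertex away from the root until it hits an
  input leg, or until it hits another unary vertex and vanishes, because \<open>\<Phi>\<^sub>1\<close> is
  \<open>\<xi>\<^sub>1 \<circ> \<xi>\<^sub>1\<close> up to sign. The trees that cannot be rewritten are the admissible ones, so they span.
  They are independent because the rewriting is confluent: the only overlap of two rules is
  \<open>\<xi>\<^sub>1 \<circ> \<xi>\<^sub>1 \<circ> \<xi>\<^sub>n\<close>, and resolving it means that the operation of composing with \<open>\<xi>\<^sub>1\<close> at the root
  and rewriting, called \<open>boundary\<close> below, has square zero (\<open>boundary_boundary\<close>).

  This is the usual argument that a family of operations satisfying the \<open>A\<^sub>\<infinity>\<close>-equations is the same
  as a square-zero coderivation of a tensor coalgebra. After every tree is multiplied by a suitable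
  sign (\<open>twist\<close>), the relations carry only the Koszul signs of the suspended trees, as in the bar
  construction (\<open>twist_relation\<close>). Let \<open>join\<close> send a word of trees to the corolla with these
  subtrees, and a word of length one to its boundary, and let \<open>bar\<close> be the sum over all ways to
  join an infix of a word. Then the definition of the boundary says exactly that \<open>join\<close> kills
  \<open>bar u\<close> whenever \<open>u\<close> has at least two letters. As \<open>bar\<close> is a coderivation
  (\<open>lin_splits_sum_bar\<close>), its square is the sum over all infixes \<open>v\<close> of \<open>join\<close> applied to \<open>bar v\<close>,
  and this vanishes by induction on the tree.

  The normal form \<open>NF\<close> of a tree is computed bottom up with \<open>join\<close>. It intertwines \<open>bar\<close> with
  \<open>raw_bar\<close>, the analogue of \<open>bar\<close> that joins a single letter to an unreduced unary corolla
  (\<open>lin_bar_NF_word\<close>);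
  since \<open>join\<close> kills \<open>bar\<close>, normal forms kill the relations, and also all trees with a relation
  grafted into a leg (\<open>NF_plug\<close>). Conversely a tree differs from its normal form by a combination
  of such grafted relations (\<open>NF_congruent\<close>). The grafted relations span the operadic ideal
  (\<open>A_ideal_eq_span\<close>), hence the ideal is the kernel of a projection onto the span of the
  admissible trees (\<open>A_ideal_eq_kernel\<close>), and the quotient is isomorphic to that span.
\<close>

section \<open>Linear combinations of basis elements\<close>

definition scale :: "'k::field \<Rightarrow> ('a \<Rightarrow>\<^sub>0 'k) \<Rightarrow> 'a \<Rightarrow>\<^sub>0 'k" where
  "scale c = Poly_Mapping.map ((*) c)"

lemma lookup_scale [simp]: "Poly_Mapping.lookup (scale c f) a = c * Poly_Mapping.lookup f a"
  by (simp add: scale_def Poly_Mapping.map.rep_eq when_def)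

global_interpretation pm: vector_space "scale :: 'k::field \<Rightarrow> ('a \<Rightarrow>\<^sub>0 'k) \<Rightarrow> _"
  by unfold_locales (auto intro!: poly_mapping_eqI simp: lookup_add algebra_simps)

lemma scale_single [simp]: "scale c (Poly_Mapping.single a d) = Poly_Mapping.single a (c * d)"
  by (rule poly_mapping_eqI) (simp add: lookup_single when_def)

definition lin :: "('a \<Rightarrow> 'b \<Rightarrow>\<^sub>0 'k) \<Rightarrow> ('a \<Rightarrow>\<^sub>0 'k) \<Rightarrow> 'b \<Rightarrow>\<^sub>0 'k::field" where
  "lin F f = (\<Sum>a\<in>Poly_Mapping.keys f. scale (Poly_Mapping.lookup f a) (F a))"

lemma lin_superset:
  "finite A \<Longrightarrow> Poly_Mapping.keys f \<subseteq> A \<Longrightarrow> lin F f = (\<Sum>a\<in>A. scale (Poly_Mapping.lookup f a) (F a))"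
  unfolding lin_def by (rule sum.mono_neutral_left) (auto simp: in_keys_iff)

lemma lin_single [simp]: "lin F (Poly_Mapping.single a c) = scale c (F a)"
  by (simp add: lin_def)

lemma lin_add: "lin F (f + g) = lin F f + lin F g"
proof -
  let ?A = "Poly_Mapping.keys f \<union> Poly_Mapping.keys g"
  have "lin F (f + g) = (\<Sum>a\<in>?A. scale (Poly_Mapping.lookup (f + g) a) (F a))"
    by (rule lin_superset) (use Poly_Mapping.keys_add[of f g] in auto)
  then show ?thesis
    by (simp add: lin_superset[of ?A f] lin_superset[of ?A g] lookup_add pm.scale_left_distrib
        sum.distrib)
qed

lemma lin_scale: "lin F (scale c f) = scale c (lin F f)"
proof -
  have "lin F (scale c f) = (\<Sum>a\<in>Poly_Mapping.keys f. scale (Poly_Mapping.lookup (scale c f) a) (F a))"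
    by (rule lin_superset) (auto simp: in_keys_iff)
  then show ?thesis by (simp add: lin_def pm.scale_sum_right)
qed

abbreviation is_linear :: "(('a \<Rightarrow>\<^sub>0 'k) \<Rightarrow> ('b \<Rightarrow>\<^sub>0 'k::field)) \<Rightarrow> bool" where
  "is_linear L \<equiv> Modules.module_hom scale scale L"

lemma is_linearI:
  assumes "\<And>f g. L (f + g) = L f + L g" "\<And>c f. L (scale c f) = scale c (L f)"
  shows "is_linear L"
  using assms by unfold_locales

lemma linear_lin [intro!]: "is_linear (lin F)"
  by (rule is_linearI) (simp_all add: lin_add lin_scale)

lemma linear_scale [intro!]: "is_linear (scale c)"
  by (rule is_linearI) (simp_all add: pm.scale_right_distrib mult.commute)

lemma linear_comp: "is_linear L \<Longrightarrow> is_linear M \<Longrightarrow> is_linear (\<lambda>f. L (M f))"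
  by (rule is_linearI) (simp_all add: Modules.module_hom.add[of scale scale L]
      Modules.module_hom.add[of scale scale M]
      Modules.module_hom.scale[of scale scale L] Modules.module_hom.scale[of scale scale M])

lemmas lin_zero [simp] = Modules.module_hom.zero[OF linear_lin]
  and lin_uminus = Modules.module_hom.neg[OF linear_lin]
  and lin_diff = Modules.module_hom.diff[OF linear_lin]

lemma lin_cong: "(\<And>a. a \<in> Poly_Mapping.keys f \<Longrightarrow> F a = G a) \<Longrightarrow> lin F f = lin G f"
  by (simp add: lin_def)

lemma linear_eq_lin:
  assumes "is_linear L" shows "L f = lin (\<lambda>a. L (Poly_Mapping.single a 1)) f"
proof -
  have "f = (\<Sum>a\<in>Poly_Mapping.keys f. scale (Poly_Mapping.lookup f a) (Poly_Mapping.single a 1))"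
    by (rule poly_mapping_eqI)
      (auto simp: lookup_sum lookup_single when_def in_keys_iff if_distrib cong: if_cong)
  then have "L f = L (\<Sum>a\<in>Poly_Mapping.keys f. scale (Poly_Mapping.lookup f a) (Poly_Mapping.single a 1))"
    by simp
  also have "\<dots> = lin (\<lambda>a. L (Poly_Mapping.single a 1)) f"
    by (simp add: lin_def Modules.module_hom.sum[OF assms] Modules.module_hom.scale[OF assms]
        del: scale_single)
  finally show ?thesis .
qed

lemma linear_ext:
  assumes "is_linear L" "is_linear M"
    and "\<And>a. a \<in> Poly_Mapping.keys f \<Longrightarrow> L (Poly_Mapping.single a 1) = M (Poly_Mapping.single a 1)"
  shows "L f = M f"
  unfolding linear_eq_lin[OF assms(1), of f] linear_eq_lin[OF assms(2), of f]
  by (rule lin_cong) (rule assms(3))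

lemma linear_lin_commute: "is_linear L \<Longrightarrow> L (lin F f) = lin (\<lambda>a. L (F a)) f"
  by (simp add: lin_def Modules.module_hom.sum[of scale scale L] Modules.module_hom.scale[of scale scale L])

lemma lin_lin: "lin G (lin F f) = lin (\<lambda>a. lin G (F a)) f"
  by (rule linear_lin_commute) blast

lemma lin_id [simp]: "lin (\<lambda>a. Poly_Mapping.single a 1) f = f"
  by (rule linear_eq_lin[symmetric, of "\<lambda>f. f"]) (auto intro: is_linearI)

lemma lin_fun_add: "lin (\<lambda>a. F a + G a) f = lin F f + lin G f"
  by (simp add: lin_def pm.scale_right_distrib sum.distrib)

lemma lin_fun_diff: "lin (\<lambda>a. F a - G a) f = lin F f - lin G f"
  by (simp add: lin_def pm.scale_right_diff_distrib sum_subtractf)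

lemma lin_fun_scale: "lin (\<lambda>a. scale c (F a)) f = scale c (lin F f)"
  by (simp add: lin_def pm.scale_sum_right mult.commute)

lemma lin_fun_uminus: "lin (\<lambda>a. - F a) f = - lin F f"
  by (simp add: lin_def sum_negf)

lemma lin_fun_zero [simp]: "lin (\<lambda>a. 0) f = 0"
  by (simp add: lin_def)

definition supp :: "'a set \<Rightarrow> ('a \<Rightarrow>\<^sub>0 'k::field) set" where
  "supp A = {f. Poly_Mapping.keys f \<subseteq> A}"

lemma subspace_supp: "pm.subspace (supp A :: ('a \<Rightarrow>\<^sub>0 'k::field) set)"
proof (rule pm.subspaceI)
  fix f g :: "'a \<Rightarrow>\<^sub>0 'k"
  assume "f \<in> supp A" "g \<in> supp A"
  then show "f + g \<in> supp A"
    using Poly_Mapping.keys_add[of f g] by (auto simp: supp_def)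
qed (auto simp: supp_def in_keys_iff)

lemmas supp_0 [simp] = pm.subspace_0[OF subspace_supp]
  and supp_add = pm.subspace_add[OF subspace_supp]
  and supp_diff = pm.subspace_diff[OF subspace_supp]
  and supp_neg = pm.subspace_neg[OF subspace_supp]
  and supp_scale = pm.subspace_scale[OF subspace_supp]
  and supp_sum = pm.subspace_sum[OF subspace_supp]

lemma supp_single: "a \<in> A \<Longrightarrow> Poly_Mapping.single a c \<in> supp A"
  by (simp add: supp_def)

lemma supp_mono: "f \<in> supp A \<Longrightarrow> A \<subseteq> B \<Longrightarrow> f \<in> supp B"
  by (auto simp: supp_def)

lemma lin_in_subspace:
  "pm.subspace V \<Longrightarrow> (\<And>a. a \<in> Poly_Mapping.keys f \<Longrightarrow> F a \<in> V) \<Longrightarrow> lin F f \<in> V"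
  unfolding lin_def by (intro pm.subspace_sum pm.subspace_scale) auto

lemma lin_in_supp:
  "f \<in> supp A \<Longrightarrow> (\<And>a. a \<in> A \<Longrightarrow> F a \<in> supp B) \<Longrightarrow> lin F f \<in> supp B"
  by (rule lin_in_subspace[OF subspace_supp]) (auto simp: supp_def)

lemma lin_cong_supp: "f \<in> supp A \<Longrightarrow> (\<And>a. a \<in> A \<Longrightarrow> F a = G a) \<Longrightarrow> lin F f = lin G f"
  by (rule lin_cong) (auto simp: supp_def)

section \<open>The tensor algebra\<close>

text \<open>
  Words are the monoid with concatenation as addition, so that the convolution product of
  \<open>Poly_Mapping\<close> makes \<open>'a list \<Rightarrow>\<^sub>0 'k\<close> the free associative algebra on \<open>'a\<close>, which is
  the tensor algebra on \<open>'a \<Rightarrow>\<^sub>0 'k\<close>.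
\<close>

instantiation list :: (type) monoid_add
begin
definition zero_list_def: "0 = []"
definition plus_list_def: "xs + ys = xs @ ys"
instance by standard (simp_all add: zero_list_def plus_list_def)
end

abbreviation word :: "'a list \<Rightarrow> 'a list \<Rightarrow>\<^sub>0 'k::field" where
  "word u \<equiv> Poly_Mapping.single u 1"

definition letter :: "('a \<Rightarrow>\<^sub>0 'k) \<Rightarrow> 'a list \<Rightarrow>\<^sub>0 'k::field" where
  "letter = lin (\<lambda>t. word [t])"

lemma linear_letter [intro!]: "is_linear letter"
  unfolding letter_def by blast

lemma letter_single [simp]: "letter (Poly_Mapping.single t c) = Poly_Mapping.single [t] c"
  by (simp add: letter_def)

lemma word_times: "word u * word v = word (u @ v)"
  by (simp add: mult_single plus_list_def)

lemma word_Nil: "word [] = 1"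
  by (simp add: zero_list_def[symmetric])

lemma scale_eq_times: "scale c f = Poly_Mapping.single 0 c * f"
  for f :: "'a::monoid_add \<Rightarrow>\<^sub>0 'k::field"
  unfolding scale_def by (rule mult_map_scale_conv_mult)

lemma times_scale_left: "scale c f * g = scale c (f * g)"
  for f g :: "'a::monoid_add \<Rightarrow>\<^sub>0 'k::field"
  by (simp add: scale_eq_times mult.assoc)

lemma linear_times_left [intro!]: "is_linear (\<lambda>f. f * g)" for g :: "'a::monoid_add \<Rightarrow>\<^sub>0 'k::field"
  by (rule is_linearI) (simp_all add: distrib_right times_scale_left)

lemma scale_eq_times_right: "scale c f = f * Poly_Mapping.single 0 c"
  for f :: "'a::monoid_add \<Rightarrow>\<^sub>0 'k::field"
  by (rule linear_ext[where L = "scale c" and M = "\<lambda>f. f * Poly_Mapping.single 0 c"])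
    (auto simp: mult_single)

lemma times_scale_right: "f * scale c g = scale c (f * g)"
  for f g :: "'a::monoid_add \<Rightarrow>\<^sub>0 'k::field"
  by (simp add: scale_eq_times_right mult.assoc)

lemma linear_times_right [intro!]: "is_linear (\<lambda>g. f * g)" for f :: "'a::monoid_add \<Rightarrow>\<^sub>0 'k::field"
  by (rule is_linearI) (simp_all add: distrib_left times_scale_right)

lemma lin_times_left: "lin F f * g = lin (\<lambda>a. F a * g) f"
  for g :: "'a::monoid_add \<Rightarrow>\<^sub>0 'k::field"
  using linear_lin_commute[OF linear_times_left] .

lemma lin_times_right: "g * lin F f = lin (\<lambda>a. g * F a) f"
  for g :: "'a::monoid_add \<Rightarrow>\<^sub>0 'k::field"
  using linear_lin_commute[OF linear_times_right] .

section \<open>Sums over splittings of a word\<close>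

text \<open>
  The sum of \<open>f\<close> over the deconcatenation coproduct of a word. The recursion, rather than a sum
  over cut positions, is what makes coassociativity (\<open>splits_sum_assoc\<close>) and the coderivation
  property of \<open>bar\<close> plain inductions over the word.
\<close>

primrec splits_sum :: "('a list \<Rightarrow> 'a list \<Rightarrow> 'b) \<Rightarrow> 'a list \<Rightarrow> 'b::comm_monoid_add" where
  "splits_sum f [] = f [] []"
| "splits_sum f (x # xs) = f [] (x # xs) + splits_sum (\<lambda>u v. f (x # u) v) xs"

lemma splits_sum_cong:
  "(\<And>u v. w = u @ v \<Longrightarrow> f u v = g u v) \<Longrightarrow> splits_sum f w = splits_sum g w"
proof (induction w arbitrary: f g)
  case (Cons x w)
  have "splits_sum (\<lambda>u v. f (x # u) v) w = splits_sum (\<lambda>u v. g (x # u) v) w"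
    by (rule Cons.IH) (simp add: Cons.prems)
  then show ?case by (simp add: Cons.prems)
qed simp

lemma splits_sum_add:
  "splits_sum (\<lambda>u v. f u v + g u v) w = splits_sum f w + splits_sum g w"
  by (induction w arbitrary: f g) (simp_all add: add_ac)

lemma splits_sum_zero [simp]: "splits_sum (\<lambda>u v. 0) w = 0"
  by (induction w) simp_all

lemma linear_splits_sum: "is_linear L \<Longrightarrow> L (splits_sum f w) = splits_sum (\<lambda>u v. L (f u v)) w"
proof (induction w arbitrary: f)
  case (Cons x w)
  then show ?case by (simp add: Modules.module_hom.add[of scale scale L])
qed simp

lemma splits_sum_diff: "splits_sum (\<lambda>u v. f u v - g u v) w = splits_sum f w - splits_sum g w"
  for f :: "'a list \<Rightarrow> 'a list \<Rightarrow> 'b::ab_group_add"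
  by (induction w arbitrary: f g) simp_all

lemma splits_sum_assoc:
  "splits_sum (\<lambda>u v. splits_sum (\<lambda>v1 v2. f u v1 v2) v) w
     = splits_sum (\<lambda>u v. splits_sum (\<lambda>u1 u2. f u1 u2 v) u) w"
  by (induction w arbitrary: f) (simp_all add: splits_sum_add add_ac)

lemma splits_sum_in_subspace:
  "pm.subspace V \<Longrightarrow> (\<And>u v. w = u @ v \<Longrightarrow> f u v \<in> V) \<Longrightarrow> splits_sum f w \<in> V"
proof (induction w arbitrary: f)
  case (Cons x w)
  have "splits_sum (\<lambda>u v. f (x # u) v) w \<in> V"
    by (rule Cons.IH) (simp_all add: Cons.prems)
  then show ?case by (simp add: Cons.prems pm.subspace_add)
qed simp

lemma splits_sum_eq_sum:
  "splits_sum f w = (\<Sum>k\<le>length w. f (take k w) (drop k w))"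
proof (induction w arbitrary: f)
  case (Cons x w)
  show ?case
    by (simp add: Cons.IH sum.atMost_Suc_shift del: sum.atMost_Suc)
qed simp

text \<open>
  The sum over all ways to write a word as prefix, infix and suffix, with nonempty infix.
\<close>

primrec infix_sum :: "('a list \<Rightarrow> 'a list \<Rightarrow> 'a list \<Rightarrow> 'b) \<Rightarrow> 'a list \<Rightarrow> 'b::comm_monoid_add" where
  "infix_sum f [] = 0"
| "infix_sum f (x # xs) =
     splits_sum (\<lambda>u v. f [] (x # u) v) xs + infix_sum (\<lambda>p u v. f (x # p) u v) xs"

lemma infix_sum_cong:
  "(\<And>p u v. w = p @ u @ v \<Longrightarrow> u \<noteq> [] \<Longrightarrow> f p u v = g p u v) \<Longrightarrow> infix_sum f w = infix_sum g w"
proof (induction w arbitrary: f g)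
  case (Cons x w)
  have "infix_sum (\<lambda>p u v. f (x # p) u v) w = infix_sum (\<lambda>p u v. g (x # p) u v) w"
    by (rule Cons.IH) (simp add: Cons.prems)
  moreover have "splits_sum (\<lambda>u v. f [] (x # u) v) w = splits_sum (\<lambda>u v. g [] (x # u) v) w"
    by (rule splits_sum_cong) (simp add: Cons.prems)
  ultimately show ?case by simp
qed simp

lemma linear_infix_sum: "is_linear L \<Longrightarrow> L (infix_sum f w) = infix_sum (\<lambda>p u v. L (f p u v)) w"
proof (induction w arbitrary: f)
  case (Cons x w)
  then show ?case by (simp add: Modules.module_hom.add[of scale scale L] linear_splits_sum[of L])
qed (simp add: Modules.module_hom.zero[of scale scale L])

lemma infix_sum_in_subspace:
  "pm.subspace V \<Longrightarrow> (\<And>p u v. w = p @ u @ v \<Longrightarrow> u \<noteq> [] \<Longrightarrow> f p u v \<in> V) \<Longrightarrow> infix_sum f w \<in> V"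
proof (induction w arbitrary: f)
  case (Cons x w)
  have "infix_sum (\<lambda>p u v. f (x # p) u v) w \<in> V"
    by (rule Cons.IH) (simp_all add: Cons.prems)
  moreover have "splits_sum (\<lambda>u v. f [] (x # u) v) w \<in> V"
    by (rule splits_sum_in_subspace) (simp_all add: Cons.prems)
  ultimately show ?case by (simp add: Cons.prems pm.subspace_add)
qed (simp add: pm.subspace_0)

lemma infix_sum_eq_sum:
  "infix_sum f w =
     (\<Sum>l<length w. \<Sum>k\<in>{1..length w - l}. f (take l w) (take k (drop l w)) (drop (l + k) w))"
proof (induction w arbitrary: f)
  case (Cons x w)
  have *: "(\<Sum>k\<in>{1..Suc n}. g k) = (\<Sum>k\<le>n. g (Suc k))" for g :: "nat \<Rightarrow> 'c::comm_monoid_add" and n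
    using sum.shift_bounds_cl_Suc_ivl[of g 0 n] by (simp add: atMost_atLeast0)
  show ?case
    by (simp add: Cons.IH sum.lessThan_Suc_shift splits_sum_eq_sum *
        del: sum.lessThan_Suc sum.cl_ivl_Suc One_nat_def)
qed simp

section \<open>The boundary map and its square\<close>

lemma two_le_length: "u \<noteq> [] \<Longrightarrow> length u \<noteq> 1 \<Longrightarrow> 2 \<le> length u"
  by (cases u) (auto simp: Suc_le_eq)

definition psign :: "int \<Rightarrow> 'k::comm_ring_1" where
  "psign d = (if even d then 1 else - 1)"

lemma psign_add: "psign (c + d) = psign c * psign d"
  by (auto simp: psign_def)

lemma psign_sq [simp]: "psign d * psign d = 1"
  by (auto simp: psign_def)

lemma psign_0 [simp]: "psign 0 = 1"
  by (simp add: psign_def)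

lemma psign_1 [simp]: "psign 1 = - 1"
  by (simp add: psign_def)

text \<open>
  The degree in the suspension. With it all corollas have the same degree \<open>-1\<close>
  (\<open>sdeg_Vertex\<close>), and the signs of the \<open>A\<^sub>\<infinity>\<close>-relations become plain Koszul signs.
\<close>

definition sdeg :: "ptree \<Rightarrow> int" where
  "sdeg t = deg t + 1"

definition wdeg :: "ptree list \<Rightarrow> int" where
  "wdeg u = (\<Sum>t\<leftarrow>u. sdeg t)"

lemma wdeg_simps [simp]:
  "wdeg [] = 0" "wdeg (t # u) = sdeg t + wdeg u" "wdeg (u @ v) = wdeg u + wdeg v"
  by (simp_all add: wdeg_def)

lemma sdeg_Leg [simp]: "sdeg Leg = 1"
  by (simp add: sdeg_def)

lemma sdeg_Vertex [simp]: "sdeg (Vertex u) = wdeg u - 1"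
proof -
  have "wdeg u = (\<Sum>t\<leftarrow>u. deg t) + int (length u)"
    by (induction u) (simp_all add: sdeg_def)
  then show ?thesis by (simp add: sdeg_def deg_Vertex)
qed

definition vert :: "(ptree list \<Rightarrow>\<^sub>0 'k::field) \<Rightarrow> ptree \<Rightarrow>\<^sub>0 'k" where
  "vert = lin (\<lambda>u. tree (Vertex u))"

lemma linear_vert [intro!]: "is_linear vert"
  unfolding vert_def by blast

lemma vert_word [simp]: "vert (word u) = tree (Vertex u)"
  by (simp add: vert_def)

text \<open>
  The reduced form of \<open>\<xi>\<^sub>1 \<circ> t\<close> after the change of signs \<open>twist\<close> introduced further below. For a
  tree with unary root it is zero by \<open>\<Phi>\<^sub>1\<close>. For a root with \<open>n \<ge> 2\<close> inputs \<open>u\<close> it is minus the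
  sum of the other terms of \<open>\<Phi>\<^sub>n\<close>: those where \<open>\<xi>\<^sub>1\<close> acts on one input (\<open>boundary_letters\<close>), and
  those where at least two, but not all, neighbouring inputs are grouped under a new vertex. The
  term \<open>word [Vertex u]\<close> removes the grouping of all inputs, which stands for \<open>\<xi>\<^sub>1 \<circ> \<xi>\<^sub>n\<close> itself.
\<close>

fun boundary :: "ptree \<Rightarrow> ptree \<Rightarrow>\<^sub>0 'k::field"
  and boundary_letters :: "ptree list \<Rightarrow> ptree list \<Rightarrow>\<^sub>0 'k"
  and groupings :: "ptree list \<Rightarrow> ptree list \<Rightarrow>\<^sub>0 'k" where
  "boundary Leg = tree (Vertex [Leg])"
| "boundary (Vertex u) = (if length u = 1 then 0
     else - vert (boundary_letters u + groupings u - word [Vertex u]))"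
| "boundary_letters [] = 0"
| "boundary_letters (t # u) =
     letter (boundary t) * word u + scale (psign (sdeg t)) (word [t] * boundary_letters u)"
| "groupings [] = 0"
| "groupings (t # u) =
     splits_sum (\<lambda>v w. if v = [] then 0 else word (Vertex (t # v) # w)) u
     + scale (psign (sdeg t)) (word [t] * groupings u)"

text \<open>
  The normal form of the corolla with the given subtrees, if these are normal. The value on
  the empty word is zero so that \<open>join_prefix\<close> can sum over all prefixes.
\<close>

definition join :: "ptree list \<Rightarrow> ptree \<Rightarrow>\<^sub>0 'k::field" where
  "join u = (case u of [] \<Rightarrow> 0 | [t] \<Rightarrow> boundary t | _ \<Rightarrow> tree (Vertex u))"

lemma join_simps [simp]:
  "join [] = 0" "join [t] = boundary t" "2 \<le> length u \<Longrightarrow> join u = tree (Vertex u)"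
  by (auto simp: join_def split: list.splits)

definition join_prefix :: "ptree list \<Rightarrow> ptree list \<Rightarrow>\<^sub>0 'k::field" where
  "join_prefix u = splits_sum (\<lambda>v w. letter (join v) * word w) u"

lemma letter_0 [simp]: "letter 0 = 0"
  by (simp add: letter_def)

lemma join_prefix_Nil [simp]: "join_prefix [] = 0"
  by (simp add: join_prefix_def)

lemma join_prefix_Cons: "join_prefix (t # u) = splits_sum (\<lambda>v w. letter (join (t # v)) * word w) u"
  by (simp add: join_prefix_def)

text \<open>
  The bar differential: the sum over all infixes of a word of joining this infix, with the Koszul
  sign for moving an operation of odd degree past the letters before it.
\<close>

primrec bar :: "ptree list \<Rightarrow> ptree list \<Rightarrow>\<^sub>0 'k::field" where
  "bar [] = 0"
| "bar (t # u) = join_prefix (t # u) + scale (psign (sdeg t)) (word [t] * bar u)"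

lemma splits_sum_first:
  "splits_sum f u = f [] u + splits_sum (\<lambda>v w. if v = [] then 0 else f v w) u"
  by (cases u) simp_all

lemma bar_eq: "bar u = boundary_letters u + groupings u"
proof (induction u)
  case (Cons t u)
  have "join_prefix (t # u) = letter (boundary t) * word u
      + splits_sum (\<lambda>v w. if v = [] then 0 else word (Vertex (t # v) # w) :: ptree list \<Rightarrow>\<^sub>0 'a) u"
    unfolding join_prefix_Cons by (subst splits_sum_first)
      (auto intro!: splits_sum_cong simp: word_times Suc_le_eq)
  then show ?case
    by (simp add: Cons.IH distrib_left pm.scale_right_distrib)
qed simp

lemma boundary_Vertex: "length u \<noteq> 1 \<Longrightarrow> boundary (Vertex u) = - vert (bar u - word [Vertex u])"
  by (simp add: bar_eq)

declare boundary.simps(2) [simp del]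

lemma letter_times_in_supp:
  assumes "f \<in> supp A" "g \<in> supp C" "\<And>t u. t \<in> A \<Longrightarrow> u \<in> C \<Longrightarrow> t # u \<in> E"
  shows "letter f * g \<in> supp E"
proof -
  have "letter f * g = lin (\<lambda>t. lin (\<lambda>u. word (t # u)) g) f"
  proof -
    have "letter f * g = lin (\<lambda>t. word [t] * g) f"
      by (simp add: letter_def lin_times_left)
    also have "\<dots> = lin (\<lambda>t. word [t] * lin (\<lambda>u. word u) g) f" by simp
    also have "\<dots> = lin (\<lambda>t. lin (\<lambda>u. word (t # u)) g) f"
      unfolding lin_times_right word_times by simp
    finally show ?thesis .
  qed
  then show ?thesis
    using assms by (auto intro!: lin_in_supp[OF assms(1)] lin_in_supp[OF assms(2)] supp_single)
qed

lemma join_in_supp: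
  assumes "u \<noteq> []" "\<And>t. t \<in> set u \<Longrightarrow> (boundary t :: ptree \<Rightarrow>\<^sub>0 'k::field) \<in> supp {s. sdeg s = sdeg t - 1}"
  shows "(join u :: ptree \<Rightarrow>\<^sub>0 'k::field) \<in> supp {s. sdeg s = wdeg u - 1}"
proof (cases "length u = 1")
  case True
  then obtain t where "u = [t]" by (auto simp: length_Suc_conv)
  then show ?thesis using assms by simp
next
  case False
  then have "2 \<le> length u" using assms(1) by (rule two_le_length[rotated])
  then show ?thesis by (auto intro: supp_single)
qed

lemma bar_in_supp:
  assumes "\<And>t. t \<in> set u \<Longrightarrow> (boundary t :: ptree \<Rightarrow>\<^sub>0 'k::field) \<in> supp {s. sdeg s = sdeg t - 1}"
  shows "(bar u :: ptree list \<Rightarrow>\<^sub>0 'k::field) \<in> supp {v. wdeg v = wdeg u - 1}"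
  using assms
proof (induction u)
  case (Cons t u)
  have "(join_prefix (t # u) :: ptree list \<Rightarrow>\<^sub>0 'k) \<in> supp {v. wdeg v = wdeg (t # u) - 1}"
    unfolding join_prefix_Cons
  proof (rule splits_sum_in_subspace[OF subspace_supp])
    fix v w assume "u = v @ w"
    then show "letter (join (t # v)) * word w \<in> (supp {v. wdeg v = wdeg (t # u) - 1} :: (_ \<Rightarrow>\<^sub>0 'k) set)"
      using Cons.prems
      by (intro letter_times_in_supp[OF join_in_supp supp_single[of w "{w}"]]) auto
  qed
  moreover have "word [t] * bar u \<in> (supp {v. wdeg v = wdeg (t # u) - 1} :: (_ \<Rightarrow>\<^sub>0 'k) set)"
    using letter_times_in_supp[OF supp_single Cons.IH, of t "{t}"] Cons.prems by fastforce
  ultimately show ?case by (simp add: supp_add supp_scale del: wdeg_simps)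
qed simp

lemma vert_in_supp:
  "f \<in> supp A \<Longrightarrow> (\<And>u. u \<in> A \<Longrightarrow> Vertex u \<in> C) \<Longrightarrow> vert f \<in> supp C"
  unfolding vert_def by (rule lin_in_supp) (auto intro: supp_single)

text \<open>
  The boundary lowers the degree by one. The sign of the square of \<open>bar\<close> depends on this parity:
  moving a second operation past a joined letter instead of past its constituents changes the sign.
\<close>

lemma boundary_in_supp: "(boundary t :: ptree \<Rightarrow>\<^sub>0 'k::field) \<in> supp {s. sdeg s = sdeg t - 1}"
proof (induction t)
  case (Vertex u)
  show ?case
  proof (cases "length u = 1")
    case False
    have "(bar u :: ptree list \<Rightarrow>\<^sub>0 'k) \<in> supp {v. wdeg v = wdeg u - 1}"
      by (rule bar_in_supp) (rule Vertex)
    then have "bar u - word [Vertex u] \<in> (supp {v. wdeg v = wdeg u - 1} :: (_ \<Rightarrow>\<^sub>0 'k) set)"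
      by (intro supp_diff supp_single) auto
    then show ?thesis
      unfolding boundary_Vertex[OF False] by (intro supp_neg) (rule vert_in_supp, auto)
  qed (simp add: boundary.simps)
qed (simp add: supp_single)

lemma lin_letter_times_word: "lin F (letter f * word w) = lin (\<lambda>s. F (s # w)) f"
  by (simp add: letter_def lin_times_left word_times lin_lin)

lemma lin_word_times: "lin F (word u * g) = lin (\<lambda>v. F (u @ v)) g"
proof -
  have "word u * g = lin (\<lambda>v. word u * word v) g"
    using lin_times_right[of "word u" "\<lambda>v. word v" g] by simp
  then show ?thesis by (simp add: word_times lin_lin)
qed

lemma lin_splits_sum_fun:
  "lin (\<lambda>s. splits_sum (f s) w) g = splits_sum (\<lambda>u v. lin (\<lambda>s. f s u v) g) w"
  by (induction w arbitrary: f) (simp_all add: lin_fun_add)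

lemma lin_join_prefix_Cons:
  "lin F (join_prefix (t # u)) = splits_sum (\<lambda>v w. lin (\<lambda>s. F (s # w)) (join (t # v))) u"
  unfolding join_prefix_Cons by (subst linear_splits_sum[of "lin F"]) (auto simp: lin_letter_times_word)

text \<open>
  The coderivation property \<open>\<Delta> \<circ> bar = (bar \<otimes> 1 + 1 \<otimes> bar) \<circ> \<Delta>\<close>, tested against an arbitrary
  bilinear map \<open>F\<close>. When the joined letter starts the word, the claim is coassociativity of
  splittings.
\<close>

lemma lin_splits_sum_bar:
  "lin (splits_sum F) (bar u) = splits_sum (\<lambda>v w.
     lin (\<lambda>v'. F v' w) (bar v) + scale (psign (wdeg v)) (lin (F v) (bar w))) u"
proof (induction u arbitrary: F)
  case Nil
  show ?case by simp
next
  case (Cons t u)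
  have "lin (splits_sum F) (join_prefix (t # u)) = lin (F []) (join_prefix (t # u))
      + splits_sum (\<lambda>v w. splits_sum (\<lambda>w1 w2. lin (\<lambda>s. F (s # w1) w2) (join (t # v))) w) u"
    by (simp add: lin_join_prefix_Cons lin_fun_add lin_splits_sum_fun splits_sum_add)
  also have "splits_sum (\<lambda>v w. splits_sum (\<lambda>w1 w2. lin (\<lambda>s. F (s # w1) w2) (join (t # v))) w) u
      = splits_sum (\<lambda>v w. lin (\<lambda>v'. F v' w) (join_prefix (t # v))) u"
    by (simp add: lin_join_prefix_Cons splits_sum_assoc)
  finally have prefix_part: "lin (splits_sum F) (join_prefix (t # u)) = lin (F []) (join_prefix (t # u))
      + splits_sum (\<lambda>v w. lin (\<lambda>v'. F v' w) (join_prefix (t # v))) u" .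
  have "lin (splits_sum F) (word [t] * bar u) = lin (F []) (word [t] * bar u)
      + splits_sum (\<lambda>v w. lin (\<lambda>v'. F v' w) (word [t] * bar v)
          + scale (psign (wdeg v)) (lin (F (t # v)) (bar w))) u"
    by (simp add: lin_word_times lin_fun_add Cons.IH)
  then have "lin (splits_sum F) (bar (t # u)) = lin (F []) (bar (t # u))
      + splits_sum (\<lambda>v w. lin (\<lambda>v'. F v' w) (join_prefix (t # v))
          + scale (psign (sdeg t)) (lin (\<lambda>v'. F v' w) (word [t] * bar v)
          + scale (psign (wdeg v)) (lin (F (t # v)) (bar w)))) u"
    by (simp add: prefix_part lin_add lin_scale pm.scale_right_distrib splits_sum_add
        linear_splits_sum[of "scale (psign (sdeg t))"] linear_scale)
  then show ?case
    by (simp add: lin_add lin_scale pm.scale_right_distrib psign_add add_ac)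
qed

text \<open>
  After a prefix has been joined, \<open>bar\<close> acts either on an infix that contains the new letter, or on
  the remaining word behind it; the sign of the latter is opposite to that of the old prefix.
\<close>

lemma lin_bar_join_prefix_Cons:
  "lin bar (join_prefix (t # u)) = lin join_prefix (join_prefix (t # u))
     - splits_sum (\<lambda>v w. scale (psign (wdeg (t # v))) (letter (join (t # v)) * bar w)) u"
proof -
  have *: "lin (\<lambda>s. bar (s # w)) (join (t # v)) = lin (\<lambda>s. join_prefix (s # w)) (join (t # v))
      - scale (psign (wdeg (t # v))) (letter (join (t # v)) * bar w)" for v w
  proof -
    have "join (t # v) \<in> supp {s. sdeg s = wdeg (t # v) - 1}"
      by (rule join_in_supp) (auto intro: boundary_in_supp)
    then have "lin (\<lambda>s. bar (s # w)) (join (t # v))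
        = lin (\<lambda>s. join_prefix (s # w) - scale (psign (wdeg (t # v))) (word [s] * bar w)) (join (t # v))"
      by (rule lin_cong_supp) (auto simp: psign_def)
    then show ?thesis
      by (simp add: lin_fun_diff lin_fun_scale letter_def lin_times_left)
  qed
  show ?thesis
    by (simp add: lin_join_prefix_Cons * splits_sum_diff del: bar.simps wdeg_simps)
qed

lemma lin_join_prefix: "lin join_prefix f = lin (splits_sum (\<lambda>v w. letter (join v) * word w)) f"
  by (rule lin_cong) (simp add: join_prefix_def)

lemma lin_letter_join: "lin (\<lambda>v. letter (join v) * g) f = letter (lin join f) * g"
  by (simp add: linear_lin_commute[OF linear_letter] lin_times_left)

lemma lin_join_prefix_bar:
  "lin join_prefix (bar (t # u)) = splits_sum (\<lambda>v w. letter (lin join (bar (t # v))) * word w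
     + scale (psign (wdeg (t # v))) (letter (join (t # v)) * bar w)) u"
proof -
  have *: "lin (\<lambda>w. letter f * word w) g = letter f * g" for f :: "ptree \<Rightarrow>\<^sub>0 'k::field" and g
    using lin_times_right[of "letter f" "\<lambda>w. word w" g] by simp
  show ?thesis
    unfolding lin_join_prefix lin_splits_sum_bar
    by (simp add: lin_letter_join * del: bar.simps(2) wdeg_simps(2))
qed

text \<open>
  In \<open>bar (bar u)\<close> the two operations act either on disjoint infixes, and these terms cancel in
  pairs by the Koszul sign, or one inside the other, and these terms are grouped by the outer infix
  \<open>v\<close> into \<open>join\<close> of \<open>bar v\<close>. In the induction only infixes that start the word remain to be
  compared, and the coderivation property evaluates them.
\<close>

lemma bar_bar:
  assumes "\<And>v. v \<noteq> [] \<Longrightarrow> set v \<subseteq> set u \<Longrightarrow> lin join (bar v) = (0 :: ptree \<Rightarrow>\<^sub>0 'k::field)"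
  shows "lin bar (bar u) = (0 :: ptree list \<Rightarrow>\<^sub>0 'k)"
  using assms
proof (induction u)
  case (Cons t u)
  have IH: "lin bar (bar u) = (0 :: ptree list \<Rightarrow>\<^sub>0 'k)"
    by (rule Cons.IH) (use Cons.prems in auto)
  have "lin bar (word [t] * bar u) = lin (\<lambda>v. join_prefix (t # v)) (bar u)
      + scale (psign (sdeg t)) (lin (\<lambda>v. word [t] * bar v) (bar u) :: ptree list \<Rightarrow>\<^sub>0 'k)"
    by (simp add: lin_word_times lin_fun_add lin_fun_scale)
  also have "lin (\<lambda>v. word [t] * bar v) (bar u) = word [t] * (lin bar (bar u) :: ptree list \<Rightarrow>\<^sub>0 'k)"
    by (simp add: lin_times_right)
  finally have "lin bar (word [t] * bar u) = (lin join_prefix (word [t] * bar u) :: ptree list \<Rightarrow>\<^sub>0 'k)"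
    by (simp add: IH lin_word_times)
  then have "lin bar (bar (t # u)) = lin join_prefix (bar (t # u))
      - splits_sum (\<lambda>v w. scale (psign (wdeg (t # v))) (letter (join (t # v)) * (bar w :: _ \<Rightarrow>\<^sub>0 'k))) u"
    by (simp add: lin_add lin_scale lin_bar_join_prefix_Cons del: wdeg_simps)
  also have "\<dots> = splits_sum (\<lambda>v w. letter (lin join (bar (t # v))) * word w) u"
    by (simp add: lin_join_prefix_bar splits_sum_add del: wdeg_simps bar.simps)
  also have "\<dots> = splits_sum (\<lambda>v w. 0) u"
  proof (rule splits_sum_cong)
    fix v w assume "u = v @ w"
    then have "lin join (bar (t # v)) = (0 :: ptree \<Rightarrow>\<^sub>0 'k)" by (intro Cons.prems) auto
    then show "letter (lin join (bar (t # v))) * word w = (0 :: ptree list \<Rightarrow>\<^sub>0 'k)"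
      by (simp del: bar.simps)
  qed
  finally show ?case by simp
qed simp

lemma lin_join_eq_vert:
  "f \<in> supp {v. 2 \<le> length v} \<Longrightarrow> lin join f = vert f"
  unfolding vert_def by (rule lin_cong_supp) auto

lemma lin_boundary_vert: "lin boundary (vert f) = lin (\<lambda>v. boundary (Vertex v)) f"
  by (simp add: vert_def lin_lin)

lemma splits_sum_last:
  "splits_sum f u = f u [] + splits_sum (\<lambda>v w. if w = [] then 0 else f v w) u"
proof (induction u arbitrary: f)
  case (Cons x u)
  show ?case
    using Cons.IH[of "\<lambda>v w. f (x # v) w"] by (simp add: add_ac)
qed simp

lemma bar_in_supp_nonempty: "bar u \<in> supp {v. v \<noteq> []}"
proof (induction u)
  case (Cons t u)
  show ?case
    unfolding bar.simps join_prefix_Cons letter_single[symmetric]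
    by (intro supp_add supp_scale splits_sum_in_subspace[OF subspace_supp]
        letter_times_in_supp[of _ UNIV _ UNIV])
      (auto simp: supp_def)
qed simp

text \<open>
  Only joining a whole word gives a word with a single letter. On the other words \<open>join\<close> is just
  \<open>vert\<close>, which is what makes the recursive definition of the boundary usable.
\<close>

lemma bar_minus_top_in_supp:
  assumes "2 \<le> length u"
  shows "bar u - word [Vertex u] \<in> (supp {v. 2 \<le> length v} :: (_ \<Rightarrow>\<^sub>0 'k::field) set)"
proof -
  obtain t u' where u: "u = t # u'" and "u' \<noteq> []"
    using assms by (cases u) (auto simp: Suc_le_eq)
  have "bar u - word [Vertex u]
      = splits_sum (\<lambda>v w. if w = [] then 0 else letter (join (t # v)) * word w) u'
        + scale (psign (sdeg t)) (word [t] * bar u' :: _ \<Rightarrow>\<^sub>0 'k)"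
    unfolding u bar.simps join_prefix_Cons
    by (subst splits_sum_last) (use assms u in \<open>simp add: word_Nil\<close>)
  moreover have "splits_sum (\<lambda>v w. if w = [] then 0 else letter (join (t # v)) * word w) u'
      \<in> (supp {v. 2 \<le> length v} :: (_ \<Rightarrow>\<^sub>0 'k) set)"
  proof (rule splits_sum_in_subspace[OF subspace_supp])
    fix v w
    show "(if w = [] then 0 else letter (join (t # v)) * word w)
        \<in> (supp {v. 2 \<le> length v} :: (_ \<Rightarrow>\<^sub>0 'k) set)"
    proof (cases "w = []")
      case False
      have "letter (join (t # v)) * word w \<in> (supp {v. 2 \<le> length v} :: (_ \<Rightarrow>\<^sub>0 'k) set)"
        by (rule letter_times_in_supp[of _ UNIV _ "{w}"])
          (use False in \<open>auto simp: supp_def Suc_le_eq\<close>)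
      with False show ?thesis by simp
    qed simp
  qed
  moreover have "word [t] * bar u' \<in> (supp {v. 2 \<le> length v} :: (_ \<Rightarrow>\<^sub>0 'k) set)"
    unfolding letter_single[symmetric]
    by (rule letter_times_in_supp[OF supp_single[of t "{t}"] bar_in_supp_nonempty[of u']])
      (simp_all add: Suc_le_eq)
  ultimately show ?thesis by (simp only: supp_add supp_scale)
qed

text \<open>
  The definition of the boundary, read as an equation: the term that joins the whole word
  contributes the boundary of the corolla, which is minus the sum of all other terms.
\<close>

lemma join_bar_long:
  assumes "2 \<le> length u"
  shows "lin join (bar u) = 0"
proof -
  have "lin join (bar u) = lin join (bar u - word [Vertex u]) + boundary (Vertex u)"
    by (simp add: lin_diff)
  also have "\<dots> = 0"
    using assms by (simp add: lin_join_eq_vert[OF bar_minus_top_in_supp[OF assms]] boundary_Vertex)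
  finally show ?thesis .
qed

text \<open>
  With \<open>X\<close> the sum of the terms of \<open>bar u\<close> that do not join all of \<open>u\<close>, the boundary of
  \<open>Vertex u\<close> is \<open>- vert X\<close>. Taking the boundary of each term of \<open>X\<close> gives \<open>vert (bar (bar u))\<close>, and
  two copies of the corolla with the single input \<open>boundary (Vertex u)\<close> with opposite signs. The
  former vanishes by \<open>bar_bar\<close> and the induction hypothesis for the trees in \<open>u\<close>.
\<close>

lemma boundary_boundary: "lin boundary (boundary t) = (0 :: ptree \<Rightarrow>\<^sub>0 'k::field)"
proof (induction t)
  case (Vertex u)
  consider "length u = 1" | "u = []" | "2 \<le> length u" by (cases u; cases "tl u") auto
  then show ?case
  proof cases
    case 3
    have join_bar: "lin join (bar v) = (0 :: ptree \<Rightarrow>\<^sub>0 'k)" if "v \<noteq> []" "set v \<subseteq> set u" for v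
    proof (cases "length v = 1")
      case True
      then obtain t where "v = [t]" by (auto simp: length_Suc_conv)
      then show ?thesis
        using Vertex that by (simp add: join_prefix_Cons lin_letter_times_word word_Nil[symmetric])
    qed (simp add: join_bar_long two_le_length that)
    let ?X = "bar u - word [Vertex u] :: ptree list \<Rightarrow>\<^sub>0 'k"
    have "lin boundary (boundary (Vertex u)) = - lin (\<lambda>v. boundary (Vertex v)) ?X"
      using 3 by (simp add: boundary_Vertex lin_uminus lin_boundary_vert)
    \<comment> \<open>All words in \<open>X\<close> have at least two letters, so the case of a unary root does not occur.\<close>
    also have "lin (\<lambda>v. boundary (Vertex v)) ?X = lin (\<lambda>v. - vert (bar v - word [Vertex v])) ?X"
      by (rule lin_cong_supp[OF bar_minus_top_in_supp[OF 3]]) (simp add: boundary_Vertex)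
    also have "\<dots> = - vert (lin bar ?X) + vert (lin (\<lambda>v. word [Vertex v]) ?X)"
      by (simp add: linear_lin_commute[OF linear_vert] lin_fun_uminus lin_fun_diff
          Modules.module_hom.diff[OF linear_vert])
    also have "lin bar ?X = - letter (boundary (Vertex u))"
      using bar_bar[OF join_bar] by (simp add: lin_diff join_prefix_Cons word_Nil)
    also have "lin (\<lambda>v. word [Vertex v]) ?X = - letter (boundary (Vertex u))"
      using 3 by (simp add: boundary_Vertex vert_def linear_lin_commute[OF linear_letter]
          Modules.module_hom.neg[OF linear_letter])
    finally show ?thesis by simp
  next
    case 1
    then show ?thesis by (simp add: boundary.simps(2))
  next
    case 2
    have "boundary (Vertex []) = (tree (Vertex [Vertex []]) :: ptree \<Rightarrow>\<^sub>0 'k)"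
      by (simp add: boundary_Vertex Modules.module_hom.neg[OF linear_vert])
    then show ?thesis by (simp add: 2 boundary.simps(2))
  qed
qed (simp add: boundary.simps)

lemma join_bar: "lin join (bar u) = 0"
proof (cases "length u = 1")
  case True
  then obtain t where "u = [t]" by (auto simp: length_Suc_conv)
  then show ?thesis
    using boundary_boundary[of t] by (simp add: join_prefix_Cons lin_letter_times_word word_Nil[symmetric])
qed (cases "u = []"; simp add: join_bar_long two_le_length)

section \<open>The normal form of a tree\<close>

fun NF :: "ptree \<Rightarrow> ptree \<Rightarrow>\<^sub>0 'k::field"
  and NF_word :: "ptree list \<Rightarrow> ptree list \<Rightarrow>\<^sub>0 'k" where
  "NF Leg = tree Leg"
| "NF (Vertex u) = lin join (NF_word u)"
| "NF_word [] = word []"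
| "NF_word (t # u) = letter (NF t) * NF_word u"

lemma lin_letter_times: "lin F (letter f * g) = lin (\<lambda>s. lin (\<lambda>v. F (s # v)) g) f"
proof -
  have "letter f * g = lin (\<lambda>s. word [s] * g) f"
    by (simp add: letter_def lin_times_left)
  then show ?thesis by (simp add: lin_lin lin_word_times)
qed

lemma NF_in_supp:
  "NF t \<in> (supp {s. sdeg s = sdeg t} :: (ptree \<Rightarrow>\<^sub>0 'k::field) set)"
  "NF_word u \<in> (supp {v. wdeg v = wdeg u \<and> length v = length u} :: (ptree list \<Rightarrow>\<^sub>0 'k) set)"
proof (induction t and u rule: NF_NF_word.induct)
  case (2 u)
  have "join v \<in> (supp {s. sdeg s = sdeg (Vertex u)} :: (ptree \<Rightarrow>\<^sub>0 'k) set)" if "wdeg v = wdeg u" for v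
    using join_in_supp[of v, OF _ boundary_in_supp] that by (cases "v = []") auto
  then show ?case
    unfolding NF.simps by (intro lin_in_supp[OF 2]) auto
next
  case (4 t u)
  then show ?case
    unfolding NF_word.simps by (rule letter_times_in_supp) auto
qed (auto intro: supp_single)

lemma lin_splits_sum_NF_word:
  "lin (splits_sum F) (NF_word u)
     = splits_sum (\<lambda>v w. lin (\<lambda>v'. lin (F v') (NF_word w)) (NF_word v)) u"
proof (induction u arbitrary: F)
  case (Cons t u)
  show ?case
    by (simp add: lin_letter_times lin_fun_add Cons.IH lin_splits_sum_fun)
qed simp

primrec raw_bar :: "ptree list \<Rightarrow> ptree list \<Rightarrow>\<^sub>0 'k::field" where
  "raw_bar [] = 0"
| "raw_bar (t # u) =
     splits_sum (\<lambda>v w. word (Vertex (t # v) # w)) u + scale (psign (sdeg t)) (word [t] * raw_bar u)"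

lemma raw_bar_eq_infix_sum:
  "raw_bar u = infix_sum (\<lambda>p v w. scale (psign (wdeg p)) (word (p @ Vertex v # w) :: _ \<Rightarrow>\<^sub>0 'k::field)) u"
proof (induction u)
  case (Cons t u)
  have "is_linear (\<lambda>f. scale (psign (sdeg t)) (word [t] * f :: ptree list \<Rightarrow>\<^sub>0 'k))"
    by (rule linear_comp) auto
  from linear_infix_sum[OF this, of "\<lambda>p v w. scale (psign (wdeg p)) (word (p @ Vertex v # w))" u]
  show ?case
    by (simp add: Cons.IH times_scale_right word_times psign_add del: scale_single)
qed simp

lemma lin_join_prefix_NF_word:
  "lin join_prefix (NF_word (t # u)) = splits_sum (\<lambda>v w. NF_word (Vertex (t # v) # w)) u"
proof -
  have *: "lin (\<lambda>v'. lin (\<lambda>w'. letter (join v') * word w') g) f = letter (lin join f) * g"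
    for f g :: "ptree list \<Rightarrow>\<^sub>0 'a::field"
  proof -
    have "lin (\<lambda>w'. letter (join v') * word w') g = letter (join v') * g" for v'
      using lin_times_right[of "letter (join v')" "\<lambda>w. word w" g] by simp
    then show ?thesis by (simp add: lin_letter_join)
  qed
  show ?thesis
    unfolding lin_join_prefix lin_splits_sum_NF_word * by simp
qed

text \<open>
  Reducing all letters turns the unreduced operation \<open>raw_bar\<close> into \<open>bar\<close>, since the normal form
  of a new vertex is by definition \<open>join\<close> of the normal forms of its inputs. The signs agree as
  normal forms preserve degrees.
\<close>

lemma lin_bar_NF_word:
  "lin bar (NF_word u) = (lin NF_word (raw_bar u) :: ptree list \<Rightarrow>\<^sub>0 'k::field)"
proof (induction u)
  case (Cons t u)
  have "lin (\<lambda>s. lin (\<lambda>v. scale (psign (sdeg s)) (word [s] * bar v)) (NF_word u)) (NF t)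
      = lin (\<lambda>s. scale (psign (sdeg t)) (word [s] * lin bar (NF_word u) :: _ \<Rightarrow>\<^sub>0 'k)) (NF t)"
    by (rule lin_cong_supp[OF NF_in_supp(1)]) (simp add: lin_fun_scale lin_times_right)
  also have "\<dots> = scale (psign (sdeg t)) (letter (NF t) * lin NF_word (raw_bar u))"
    by (simp add: Cons.IH lin_fun_scale letter_def lin_times_left)
  also have "\<dots> = lin NF_word (scale (psign (sdeg t)) (word [t] * raw_bar u) :: _ \<Rightarrow>\<^sub>0 'k)"
    by (simp add: lin_scale lin_word_times lin_times_right)
  finally have "lin bar (NF_word (t # u)) = (lin join_prefix (NF_word (t # u)) :: _ \<Rightarrow>\<^sub>0 'k)
      + lin NF_word (scale (psign (sdeg t)) (word [t] * raw_bar u))"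
    by (simp add: lin_letter_times lin_fun_add)
  also have "lin join_prefix (NF_word (t # u)) = lin NF_word (splits_sum (\<lambda>v w. word (Vertex (t # v) # w)) u)"
    by (simp add: lin_join_prefix_NF_word linear_splits_sum[OF linear_lin] del: NF_word.simps NF.simps)
  finally show ?case by (simp add: lin_add)
qed simp

lemma NF_relator: "lin NF (vert (raw_bar u)) = 0"
proof -
  have "lin NF (vert (raw_bar u)) = lin (\<lambda>v. lin join (NF_word v)) (raw_bar u)"
    by (simp add: vert_def lin_lin)
  also have "\<dots> = lin join (lin bar (NF_word u))"
    by (simp add: lin_bar_NF_word lin_lin)
  also have "\<dots> = 0"
    by (simp add: lin_lin join_bar)
  finally show ?thesis .
qed

text \<open>
  Normal forms are computed from the leaves to the root, so what happens below the graft depends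
  linearly on the normal form of the grafted tree.
\<close>

lemma NF_graft:
  "\<lbrakk>1 \<le> i; i \<le> legs t\<rbrakk> \<Longrightarrow>
     \<exists>L. is_linear L \<and> (\<forall>s. NF (graft t i s) = L (NF s :: ptree \<Rightarrow>\<^sub>0 'k::field))"
  "\<lbrakk>1 \<le> i; i \<le> (\<Sum>t\<leftarrow>u. legs t)\<rbrakk> \<Longrightarrow>
     \<exists>L. is_linear L \<and> (\<forall>s. NF_word (graft_forest u i s) = L (NF s :: ptree \<Rightarrow>\<^sub>0 'k::field))"
proof (induction t i Leg and u i Leg rule: graft_graft_forest.induct)
  case (1 i)
  show ?case by (rule exI[of _ "\<lambda>f. f"]) (auto intro: is_linearI)
next
  case (2 u i)
  then obtain L where L: "is_linear L" "\<forall>s. NF_word (graft_forest u i s) = L (NF s :: ptree \<Rightarrow>\<^sub>0 'k)"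
    by auto
  then show ?case
    by (intro exI[of _ "\<lambda>f. lin join (L f)"] conjI linear_comp[OF linear_lin]) simp_all
next
  case (4 t u i)
  show ?case
  proof (cases "i \<le> legs t")
    case True
    then obtain L where L: "is_linear L" "\<forall>s. NF (graft t i s) = L (NF s :: ptree \<Rightarrow>\<^sub>0 'k)"
      using 4 by auto
    then have "is_linear (\<lambda>f. letter (L f) * NF_word u)"
      by (intro linear_comp[OF linear_times_left] linear_comp[OF linear_letter])
    then show ?thesis
      using L True by (intro exI[of _ "\<lambda>f. letter (L f) * NF_word u"]) simp
  next
    case False
    then have "1 \<le> i - legs t" "i - legs t \<le> (\<Sum>t\<leftarrow>u. legs t)"
      using 4 by auto
    then obtain L where L: "is_linear L"
        "\<forall>s. NF_word (graft_forest u (i - legs t) s) = L (NF s :: ptree \<Rightarrow>\<^sub>0 'k)"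
      using "4.hyps"(2)[OF False] by blast
    then have "is_linear (\<lambda>f. letter (NF t) * L f)"
      by (intro linear_comp[OF linear_times_right])
    then show ?thesis
      using L False by (intro exI[of _ "\<lambda>f. letter (NF t) * L f"]) simp
  qed
qed simp

definition plug :: "ptree \<Rightarrow> nat \<Rightarrow> (ptree \<Rightarrow>\<^sub>0 'k::field) \<Rightarrow> ptree \<Rightarrow>\<^sub>0 'k" where
  "plug t i = lin (\<lambda>s. tree (graft t i s))"

lemma linear_plug [intro!]: "is_linear (plug t i)"
  unfolding plug_def by blast

lemma NF_plug:
  assumes "1 \<le> i" "i \<le> legs t" "lin NF f = 0"
  shows "lin NF (plug t i f) = 0"
proof -
  obtain L where L: "is_linear L" "\<forall>s. NF (graft t i s) = L (NF s :: ptree \<Rightarrow>\<^sub>0 'a)"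
    using NF_graft(1) assms by blast
  have "lin NF (plug t i f) = lin (\<lambda>s. L (NF s)) f"
    by (simp add: plug_def lin_lin L)
  also have "\<dots> = L (lin NF f)"
    by (rule linear_lin_commute[OF L(1), symmetric])
  finally show ?thesis
    using assms Modules.module_hom.zero[OF L(1)] by simp
qed

section \<open>Normal forms are combinations of admissible trees\<close>

definition bounded :: "enat \<Rightarrow> ptree \<Rightarrow> bool" where
  "bounded m t \<longleftrightarrow> (\<forall>v\<in>set (vertices t). 1 \<le> length v \<and> enat (length v) \<le> m)"

lemma bounded_Leg [simp]: "bounded m Leg"
  by (simp add: bounded_def)

lemma bounded_Vertex [simp]:
  "bounded m (Vertex u) \<longleftrightarrow> u \<noteq> [] \<and> enat (length u) \<le> m \<and> (\<forall>t\<in>set u. bounded m t)"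
  by (cases u) (auto simp: bounded_def)

lemma admissible_Leg [simp]: "admissible Leg"
  by (simp add: admissible_def)

lemma admissible_Vertex [simp]:
  "admissible (Vertex u) \<longleftrightarrow> (length u = 1 \<longrightarrow> u = [Leg]) \<and> (\<forall>t\<in>set u. admissible t)"
  by (auto simp: admissible_def input_vertex_def length_Suc_conv)

lemma ntrees_iff: "t \<in> ntrees m n \<longleftrightarrow> legs t = n \<and> bounded m t"
  by (simp add: ntrees_def bounded_def)

lemma Adm_iff: "t \<in> Adm m n \<longleftrightarrow> legs t = n \<and> bounded m t \<and> admissible t"
  by (auto simp: Adm_def ntrees_iff)

text \<open>
  Words that can arise from \<open>u\<close> by joining infixes. The bound on the length keeps the arities of
  the corollas formed from them below \<open>m\<close>.
\<close>

definition adm_words :: "enat \<Rightarrow> ptree list \<Rightarrow> ptree list set" where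
  "adm_words m u = {v. (\<Sum>t\<leftarrow>v. legs t) = (\<Sum>t\<leftarrow>u. legs t) \<and> length v \<le> length u \<and>
     (\<forall>t\<in>set v. bounded m t \<and> admissible t)}"

lemma join_in_supp_Adm:
  assumes "\<And>t. t \<in> set u \<Longrightarrow> (boundary t :: ptree \<Rightarrow>\<^sub>0 'k::field) \<in> supp (Adm m (legs t))"
    and "u \<in> adm_words m u" "enat (length u) \<le> m"
  shows "(join u :: ptree \<Rightarrow>\<^sub>0 'k::field) \<in> supp (Adm m (\<Sum>t\<leftarrow>u. legs t))"
proof -
  consider "length u = 1" | "u = []" | "2 \<le> length u" by (cases u; cases "tl u") auto
  then show ?thesis
  proof cases
    case 1
    then show ?thesis using assms(1) by (auto simp: length_Suc_conv)
  next
    case 3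
    then show ?thesis
      using assms(2,3) by (auto intro!: supp_single simp: Adm_iff adm_words_def)
  qed simp
qed

lemma bar_in_supp_adm:
  assumes "\<And>t. t \<in> set u \<Longrightarrow> (boundary t :: ptree \<Rightarrow>\<^sub>0 'k::field) \<in> supp (Adm m (legs t))"
    and "u \<in> adm_words m u" "enat (length u) \<le> m"
  shows "(bar u :: ptree list \<Rightarrow>\<^sub>0 'k) \<in> supp (adm_words m u)"
  using assms
proof (induction u)
  case (Cons t u)
  have "(join_prefix (t # u) :: ptree list \<Rightarrow>\<^sub>0 'k) \<in> supp (adm_words m (t # u))"
    unfolding join_prefix_Cons
  proof (rule splits_sum_in_subspace[OF subspace_supp])
    fix v w assume u: "u = v @ w"
    have "enat (length (t # v)) \<le> m"
      by (rule order_trans[OF _ Cons.prems(3)]) (simp add: u)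
    then have "join (t # v) \<in> (supp (Adm m (\<Sum>t\<leftarrow>t # v. legs t)) :: (_ \<Rightarrow>\<^sub>0 'k) set)"
      using Cons.prems u by (intro join_in_supp_Adm) (auto simp: adm_words_def)
    then show "letter (join (t # v)) * word w \<in> (supp (adm_words m (t # u)) :: (_ \<Rightarrow>\<^sub>0 'k) set)"
      by (rule letter_times_in_supp[OF _ supp_single[of w "{w}"]])
        (use Cons.prems u in \<open>auto simp: adm_words_def Adm_iff\<close>)
  qed
  moreover have "word [t] * bar u \<in> (supp (adm_words m (t # u)) :: (_ \<Rightarrow>\<^sub>0 'k) set)"
  proof -
    have "enat (length u) \<le> m"
      by (rule order_trans[OF _ Cons.prems(3)]) simp
    then have bu: "bar u \<in> (supp (adm_words m u) :: (_ \<Rightarrow>\<^sub>0 'k) set)"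
      using Cons.prems by (intro Cons.IH) (auto simp: adm_words_def)
    show ?thesis
      unfolding letter_single[symmetric]
      by (rule letter_times_in_supp[OF supp_single[of t "{t}"] bu])
        (use Cons.prems in \<open>auto simp: adm_words_def\<close>)
  qed
  ultimately show ?case by (simp add: supp_add supp_scale)
qed simp

lemma supp_Int: "f \<in> supp A \<Longrightarrow> f \<in> supp C \<Longrightarrow> f \<in> supp (A \<inter> C)"
  by (auto simp: supp_def)

text \<open>
  No new unary vertex arises except directly below a leg: all other vertices of the boundary have
  at least two inputs. Apart from this, vertices are only split, so the bound on the arities is kept.
\<close>

lemma boundary_in_supp_Adm:
  assumes "1 \<le> m" "bounded m t" "admissible t"
  shows "(boundary t :: ptree \<Rightarrow>\<^sub>0 'k::field) \<in> supp (Adm m (legs t))"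
  using assms(2,3)
proof (induction t)
  case Leg
  show ?case using assms(1) by (auto intro!: supp_single simp: Adm_iff one_enat_def)
next
  case (Vertex u)
  show ?case
  proof (cases "length u = 1")
    case False
    then have len: "2 \<le> length u" using Vertex.prems by (intro two_le_length) auto
    let ?X = "bar u - word [Vertex u] :: ptree list \<Rightarrow>\<^sub>0 'k"
    have u: "u \<in> adm_words m u" "enat (length u) \<le> m" "[Vertex u] \<in> adm_words m u"
      using Vertex.prems len by (auto simp: adm_words_def)
    have "?X \<in> supp (adm_words m u)"
      by (intro supp_diff bar_in_supp_adm supp_single u) (use Vertex in auto)
    with bar_minus_top_in_supp[OF len] have "?X \<in> supp ({v. 2 \<le> length v} \<inter> adm_words m u)"
      by (intro supp_Int)
    then have "vert ?X \<in> supp (Adm m (legs (Vertex u)))"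
    proof (rule vert_in_supp)
      fix v assume v: "v \<in> {v. 2 \<le> length v} \<inter> adm_words m u"
      then have "enat (length v) \<le> m"
        by (intro order_trans[OF _ u(2)]) (simp add: adm_words_def)
      with v show "Vertex v \<in> Adm m (legs (Vertex u))"
        by (auto simp: Adm_iff adm_words_def)
    qed
    then show ?thesis unfolding boundary_Vertex[OF False] by (rule supp_neg)
  qed (simp add: boundary.simps(2))
qed

lemma NF_in_supp_Adm:
  assumes "1 \<le> m"
  shows "bounded m t \<Longrightarrow> NF t \<in> (supp (Adm m (legs t)) :: (ptree \<Rightarrow>\<^sub>0 'k::field) set)"
    and "\<lbrakk>enat (length u) \<le> m; \<forall>t\<in>set u. bounded m t\<rbrakk> \<Longrightarrow>
      NF_word u \<in> (supp (adm_words m u) :: (ptree list \<Rightarrow>\<^sub>0 'k) set)"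
proof (induction t and u rule: NF_NF_word.induct)
  case (2 u)
  then have "NF_word u \<in> (supp (adm_words m u) :: (ptree list \<Rightarrow>\<^sub>0 'k) set)" by simp
  then show ?case
    unfolding NF.simps
  proof (rule lin_in_supp)
    fix v assume v: "v \<in> adm_words m u"
    then have "enat (length v) \<le> m"
      using 2 by (auto simp: adm_words_def elim: order_trans[rotated])
    then have "join v \<in> (supp (Adm m (\<Sum>t\<leftarrow>v. legs t)) :: (_ \<Rightarrow>\<^sub>0 'k) set)"
      using v by (intro join_in_supp_Adm boundary_in_supp_Adm assms) (auto simp: adm_words_def)
    then show "join v \<in> (supp (Adm m (legs (Vertex u))) :: (_ \<Rightarrow>\<^sub>0 'k) set)"
      using v by (simp add: adm_words_def)
  qed
next
  case (4 t u)
  have "enat (length u) \<le> m"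
    by (rule order_trans[OF _ 4(3)]) simp
  then show ?case
    using 4 unfolding NF_word.simps
    by (intro letter_times_in_supp[of _ "Adm m (legs t)" _ "adm_words m u"])
      (auto simp: adm_words_def Adm_iff)
qed (auto intro!: supp_single simp: Adm_iff adm_words_def)

lemma NF_admissible:
  "\<lbrakk>bounded m t; admissible t\<rbrakk> \<Longrightarrow> NF t = (tree t :: ptree \<Rightarrow>\<^sub>0 'k::field)"
  and NF_word_admissible:
  "\<forall>t\<in>set u. bounded m t \<and> admissible t \<Longrightarrow> NF_word u = (word u :: ptree list \<Rightarrow>\<^sub>0 'k)"
proof (induction t and u rule: NF_NF_word.induct)
  case (2 u)
  show ?case
  proof (cases "length u = 1")
    case True
    then show ?thesis using 2 by (auto simp: word_times)
  next
    case False
    then show ?thesis using 2 two_le_length[of u] by auto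
  qed
qed (auto simp: word_times)

section \<open>Every tree is congruent to its normal form\<close>

text \<open>
  Trees with one of the relations, here without signs, grafted into a leg. The relation is
  \<open>vert (raw_bar u)\<close>, where \<open>u\<close> lists the trees that are already attached to its inputs.
\<close>

definition twisted_relators :: "enat \<Rightarrow> nat \<Rightarrow> (ptree \<Rightarrow>\<^sub>0 'k::field) set" where
  "twisted_relators m n = {plug t i (vert (raw_bar u)) | t i u. bounded m t \<and> 1 \<le> i \<and> i \<le> legs t \<and>
     bounded m (Vertex u) \<and> legs t + legs (Vertex u) = n + 1}"

lemma bounded_graft:
  assumes "bounded m t" "bounded m s"
  shows "bounded m (graft t i s)"
  using assms vertices_graft(1)[of _ t i s] by (fastforce simp: bounded_def)

lemma plug_plug:
  assumes "1 \<le> i" "i \<le> legs t" "1 \<le> j" "j \<le> legs s"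
  shows "plug t i (plug s j f) = plug (graft t i s) (i + j - 1) f"
  using graft_sequential(1)[OF assms] by (simp add: plug_def lin_lin)

lemma plug_in_span:
  assumes "f \<in> pm.span (twisted_relators m n)" "bounded m t" "1 \<le> i" "i \<le> legs t"
  shows "plug t i f \<in> pm.span (twisted_relators m (legs t + n - 1))"
  using assms(1)
proof (induction rule: pm.span_induct_alt)
  case base
  then show ?case by (simp add: Modules.module_hom.zero[OF linear_plug] pm.span_zero)
next
  case (step c0 x y)
  from step(1) obtain s j u where x: "x = plug s j (vert (raw_bar u))" "bounded m s" "1 \<le> j" "j \<le> legs s"
    "bounded m (Vertex u)" "legs s + legs (Vertex u) = n + 1"
    unfolding twisted_relators_def by blast
  have "plug t i x \<in> twisted_relators m (legs t + n - 1)"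
    unfolding twisted_relators_def
    using x assms legs_graft(1)[of i t s]
    by (auto simp: plug_plug intro!: exI[of _ "graft t i s"] exI[of _ "i + j - 1"] exI[of _ u]
        bounded_graft)
  then show ?case
    using step by (simp add: Modules.module_hom.add[OF linear_plug] Modules.module_hom.scale[OF linear_plug]
        pm.span_add pm.span_scale pm.span_base)
qed

lemma graft_forest_insert:
  "graft_forest (p @ Leg # w) ((\<Sum>t\<leftarrow>p. legs t) + 1) s = p @ s # w"
  by (induction p) auto

text \<open>
  Replacing one input of a vertex is a graft into the tree that has a leg at this place.
\<close>

lemma vert_context_in_span:
  assumes "f \<in> pm.span (twisted_relators m n)" "enat (length p + length w + 1) \<le> m"
    "\<forall>t\<in>set p \<union> set w. bounded m t"
  shows "vert (word p * letter f * word w)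
    \<in> pm.span (twisted_relators m ((\<Sum>t\<leftarrow>p. legs t) + n + (\<Sum>t\<leftarrow>w. legs t)))"
proof -
  have "vert (word p * letter f * word w) = plug (Vertex (p @ Leg # w)) ((\<Sum>t\<leftarrow>p. legs t) + 1) f"
    using graft_forest_insert[of p w]
    by (simp add: plug_def letter_def lin_times_left lin_times_right word_times
        linear_lin_commute[OF linear_vert])
  then show ?thesis
    using plug_in_span[OF assms(1), of "Vertex (p @ Leg # w)" "(\<Sum>t\<leftarrow>p. legs t) + 1"] assms
    by (auto simp: add_ac)
qed

lemma relator_in_span:
  assumes "bounded m (Vertex u)"
  shows "(vert (raw_bar u) :: ptree \<Rightarrow>\<^sub>0 'k::field) \<in> pm.span (twisted_relators m (legs (Vertex u)))"
proof (rule pm.span_base)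
  have "vert (raw_bar u) = (plug Leg 1 (vert (raw_bar u)) :: ptree \<Rightarrow>\<^sub>0 'k)"
    by (simp add: plug_def)
  then show "(vert (raw_bar u) :: ptree \<Rightarrow>\<^sub>0 'k) \<in> twisted_relators m (legs (Vertex u))"
    using assms unfolding twisted_relators_def
    by (intro CollectI exI[of _ Leg] exI[of _ 1] exI[of _ u]) simp
qed

lemma in_span_trans:
  "\<lbrakk>f - g \<in> pm.span A; g - h \<in> pm.span A\<rbrakk> \<Longrightarrow> f - h \<in> pm.span A"
  using pm.span_add[of "f - g" A "g - h"] by simp

lemma bar_minus_raw_bar:
  "bar u - raw_bar u = infix_sum (\<lambda>p v w. if length v = 1
     then scale (psign (wdeg p)) (word p * letter (boundary (hd v) - tree (Vertex v)) * word w)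
     else (0 :: ptree list \<Rightarrow>\<^sub>0 'k::field)) u"
proof (induction u)
  case (Cons t u)
  let ?f = "\<lambda>p v w. if length v = 1
     then scale (psign (wdeg p)) (word p * letter (boundary (hd v) - tree (Vertex v)) * word w)
     else (0 :: ptree list \<Rightarrow>\<^sub>0 'k)"
  have "is_linear (\<lambda>f. scale (psign (sdeg t)) (word [t] * f :: ptree list \<Rightarrow>\<^sub>0 'k))"
    by (rule linear_comp) auto
  from linear_infix_sum[OF this, of ?f u]
  have "scale (psign (sdeg t)) (word [t] * (bar u - raw_bar u)) = infix_sum (\<lambda>p v w. ?f (t # p) v w) u"
    unfolding Cons.IH
    by (rule trans)
      (auto intro!: infix_sum_cong simp: times_scale_right psign_add word_times mult.assoc[symmetric])
  moreover have "join_prefix (t # u) - splits_sum (\<lambda>v w. word (Vertex (t # v) # w)) u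
      = splits_sum (\<lambda>v w. ?f [] (t # v) w) u"
    unfolding join_prefix_Cons splits_sum_diff[symmetric]
  proof (rule splits_sum_cong)
    fix v w
    show "letter (join (t # v)) * word w - word (Vertex (t # v) # w) = ?f [] (t # v) w"
      by (cases v) (simp_all add: word_Nil Modules.module_hom.diff[OF linear_letter] word_times
          left_diff_distrib)
  qed
  ultimately show ?case
    by (simp add: right_diff_distrib pm.scale_right_diff_distrib algebra_simps)
qed simp

text \<open>
  For \<open>t = Vertex u\<close> the relation is \<open>vert (raw_bar u)\<close>; it contains \<open>Vertex [t]\<close>, and its other
  terms differ from those of the boundary in that \<open>Vertex [s]\<close> stands in place of the boundary of
  an input \<open>s\<close>. The induction hypothesis for \<open>s\<close> accounts for this difference.
\<close>

lemma unary_in_span: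
  assumes "1 \<le> m" "bounded m t"
  shows "tree (Vertex [t]) - boundary t \<in> (pm.span (twisted_relators m (legs t)) :: (ptree \<Rightarrow>\<^sub>0 'k::field) set)"
  using assms(2)
proof (induction t)
  case Leg
  show ?case by (simp add: pm.span_zero)
next
  case (Vertex u)
  show ?case
  proof (cases "length u = 1")
    case True
    then obtain s where u: "u = [s]" by (auto simp: length_Suc_conv)
    have "vert (raw_bar u) = (tree (Vertex [Vertex u]) :: ptree \<Rightarrow>\<^sub>0 'k)"
      by (simp add: u)
    then show ?thesis
      using relator_in_span[OF Vertex.prems, where 'k = 'k] by (simp add: boundary.simps(2) True)
  next
    case False
    have "tree (Vertex [Vertex u]) - boundary (Vertex u) = (vert (bar u) :: _ \<Rightarrow>\<^sub>0 'k)"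
      using False by (simp add: boundary_Vertex Modules.module_hom.diff[OF linear_vert])
    also have "\<dots> = vert (raw_bar u) + vert (bar u - raw_bar u)"
      by (simp add: Modules.module_hom.diff[OF linear_vert])
    finally have eq: "tree (Vertex [Vertex u]) - boundary (Vertex u)
        = vert (raw_bar u) + (vert (bar u - raw_bar u) :: _ \<Rightarrow>\<^sub>0 'k)" .
    have "vert (bar u - raw_bar u) \<in> (pm.span (twisted_relators m (legs (Vertex u))) :: (_ \<Rightarrow>\<^sub>0 'k) set)"
      unfolding bar_minus_raw_bar linear_infix_sum[OF linear_vert]
    proof (rule infix_sum_in_subspace[OF pm.subspace_span])
      fix p v w assume pvw: "u = p @ v @ w"
      show "vert (if length v = 1
          then scale (psign (wdeg p)) (word p * letter (boundary (hd v) - tree (Vertex v)) * word w) else 0)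
        \<in> (pm.span (twisted_relators m (legs (Vertex u))) :: (_ \<Rightarrow>\<^sub>0 'k) set)"
      proof (cases "length v = 1")
        case True
        then obtain s where v: "v = [s]" by (auto simp: length_Suc_conv)
        have "tree (Vertex [s]) - boundary s \<in> (pm.span (twisted_relators m (legs s)) :: (_ \<Rightarrow>\<^sub>0 'k) set)"
          using Vertex pvw v by simp
        from pm.span_neg[OF this]
        have "vert (word p * letter (boundary s - tree (Vertex [s])) * word w)
          \<in> (pm.span (twisted_relators m ((\<Sum>t\<leftarrow>p. legs t) + legs s + (\<Sum>t\<leftarrow>w. legs t))) :: (_ \<Rightarrow>\<^sub>0 'k) set)"
          by (intro vert_context_in_span) (use Vertex.prems in \<open>auto simp: pvw v\<close>)
        then show ?thesis
          by (simp add: v pvw pm.span_scale Modules.module_hom.scale[OF linear_vert] add_ac)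
      qed (simp add: pm.span_zero Modules.module_hom.zero[OF linear_vert])
    qed
    then show ?thesis
      unfolding eq by (intro pm.span_add relator_in_span Vertex.prems)
  qed
qed

text \<open>
  The letters are replaced by their normal forms one at a time; \<open>p\<close> holds those that the induction
  over \<open>u\<close> has passed.
\<close>

lemma vert_NF_word_in_span:
  assumes "1 \<le> m"
    and "\<And>t. t \<in> set u \<Longrightarrow> tree t - NF t \<in> (pm.span (twisted_relators m (legs t)) :: (ptree \<Rightarrow>\<^sub>0 'k::field) set)"
    and "enat (length (p @ u)) \<le> m" "\<forall>t\<in>set (p @ u). bounded m t"
  shows "vert (word (p @ u) - word p * NF_word u)
    \<in> (pm.span (twisted_relators m (legs (Vertex (p @ u)))) :: (ptree \<Rightarrow>\<^sub>0 'k) set)"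
  using assms(2-)
proof (induction u arbitrary: p)
  case (Cons t u)
  have "vert (word (p @ t # u) - word (p @ [t]) * NF_word u)
      \<in> (pm.span (twisted_relators m (legs (Vertex (p @ t # u)))) :: (ptree \<Rightarrow>\<^sub>0 'k) set)"
    using Cons.IH[of "p @ [t]"] Cons.prems by simp
  moreover have "vert (word (p @ [t]) * NF_word u - word p * NF_word (t # u))
      \<in> (pm.span (twisted_relators m (legs (Vertex (p @ t # u)))) :: (ptree \<Rightarrow>\<^sub>0 'k) set)"
  proof -
    have "enat (length u) \<le> m"
      by (rule order_trans[OF _ Cons.prems(2)]) simp
    then have u: "NF_word u \<in> (supp (adm_words m u) :: (ptree list \<Rightarrow>\<^sub>0 'k) set)"
      using Cons.prems by (intro NF_in_supp_Adm(2) assms(1)) auto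
    have "word (p @ [t]) * NF_word u - word p * NF_word (t # u)
        = word p * letter (tree t - NF t) * NF_word u"
      by (simp add: word_times[of p "[t]", symmetric] Modules.module_hom.diff[OF linear_letter]
          left_diff_distrib right_diff_distrib mult.assoc)
    also have "\<dots> = lin (\<lambda>w. word p * letter (tree t - NF t) * word w) (NF_word u)"
      using lin_times_right[of "word p * letter (tree t - NF t)" "\<lambda>w. word w" "NF_word u"] by simp
    finally have eq: "word (p @ [t]) * NF_word u - word p * NF_word (t # u)
        = lin (\<lambda>w. word p * letter (tree t - NF t) * word w) (NF_word u :: _ \<Rightarrow>\<^sub>0 'k)" .
    have "vert (word (p @ [t]) * NF_word u - word p * NF_word (t # u))
        = lin (\<lambda>w. vert (word p * letter (tree t - NF t) * word w)) (NF_word u :: _ \<Rightarrow>\<^sub>0 'k)"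
      unfolding eq by (rule linear_lin_commute[OF linear_vert])
    also have "\<dots> \<in> pm.span (twisted_relators m (legs (Vertex (p @ t # u))))"
    proof (rule lin_in_subspace[OF pm.subspace_span])
      fix w assume "w \<in> Poly_Mapping.keys (NF_word u :: _ \<Rightarrow>\<^sub>0 'k)"
      then have w: "w \<in> adm_words m u" using u by (auto simp: supp_def)
      then have "enat (length p + length w + 1) \<le> m"
        by (intro order_trans[OF _ Cons.prems(2)]) (simp add: adm_words_def)
      then have "vert (word p * letter (tree t - NF t) * word w)
          \<in> (pm.span (twisted_relators m ((\<Sum>t\<leftarrow>p. legs t) + legs t + (\<Sum>t\<leftarrow>w. legs t))) :: (_ \<Rightarrow>\<^sub>0 'k) set)"
        using Cons.prems w by (intro vert_context_in_span) (auto simp: adm_words_def)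
      then show "vert (word p * letter (tree t - NF t) * word w)
          \<in> (pm.span (twisted_relators m (legs (Vertex (p @ t # u)))) :: (_ \<Rightarrow>\<^sub>0 'k) set)"
        using w by (simp add: adm_words_def add_ac)
    qed
    finally show ?thesis .
  qed
  ultimately show ?case
    using in_span_trans by (simp add: Modules.module_hom.diff[OF linear_vert]) blast
qed (simp add: pm.span_zero Modules.module_hom.zero[OF linear_vert] word_Nil)

lemma NF_congruent:
  assumes "1 \<le> m" "bounded m t"
  shows "tree t - NF t \<in> (pm.span (twisted_relators m (legs t)) :: (ptree \<Rightarrow>\<^sub>0 'k::field) set)"
  using assms(2)
proof (induction t)
  case (Vertex u)
  have "vert (word ([] @ u) - word [] * NF_word u)
      \<in> (pm.span (twisted_relators m (legs (Vertex ([] @ u)))) :: (ptree \<Rightarrow>\<^sub>0 'k) set)"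
    using Vertex by (intro vert_NF_word_in_span assms(1)) auto
  then have 1: "tree (Vertex u) - vert (NF_word u)
      \<in> (pm.span (twisted_relators m (legs (Vertex u))) :: (ptree \<Rightarrow>\<^sub>0 'k) set)"
    by (simp add: word_Nil Modules.module_hom.diff[OF linear_vert])
  have 2: "vert (NF_word u) - lin join (NF_word u)
      \<in> (pm.span (twisted_relators m (legs (Vertex u))) :: (ptree \<Rightarrow>\<^sub>0 'k) set)"
  proof (cases "length u = 1")
    case True
    then obtain s where u: "u = [s]" by (auto simp: length_Suc_conv)
    have s: "NF s \<in> (supp (Adm m (legs s)) :: (ptree \<Rightarrow>\<^sub>0 'k) set)"
      using Vertex.prems u by (intro NF_in_supp_Adm(1) assms(1)) simp
    have "vert (NF_word u) - lin join (NF_word u) = lin (\<lambda>r. tree (Vertex [r]) - boundary r) (NF s :: _ \<Rightarrow>\<^sub>0 'k)"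
      by (simp add: u vert_def lin_letter_times_word lin_fun_diff)
    also have "\<dots> \<in> pm.span (twisted_relators m (legs (Vertex u)))"
    proof (rule lin_in_subspace[OF pm.subspace_span])
      fix r assume "r \<in> Poly_Mapping.keys (NF s :: _ \<Rightarrow>\<^sub>0 'k)"
      then have "r \<in> Adm m (legs s)" using s by (auto simp: supp_def)
      then show "tree (Vertex [r]) - boundary r \<in> (pm.span (twisted_relators m (legs (Vertex u))) :: (_ \<Rightarrow>\<^sub>0 'k) set)"
        using unary_in_span[OF assms(1), of r] by (simp add: u Adm_iff)
    qed
    finally show ?thesis .
  next
    case False
    then have "2 \<le> length u" using Vertex.prems by (intro two_le_length) auto
    then have "NF_word u \<in> (supp {v. 2 \<le> length v} :: (ptree list \<Rightarrow>\<^sub>0 'k) set)"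
      by (intro supp_mono[OF NF_in_supp(2)]) auto
    then show ?thesis by (simp add: lin_join_eq_vert pm.span_zero)
  qed
  from in_span_trans[OF 1 2] show ?case by simp
qed (simp add: pm.span_zero)

section \<open>Signs\<close>

text \<open>
  The exponent \<open>\<Sum>\<^sub>j (n - j) |t\<^sub>j|\<close> of the sign that comes from suspending an operation with \<open>n\<close>
  inputs, where \<open>|t\<^sub>j|\<close> is the suspended degree of the \<open>j\<close>-th input.
\<close>

fun position_sign :: "ptree list \<Rightarrow> int" where
  "position_sign [] = 0"
| "position_sign (t # u) = int (length u) * sdeg t + position_sign u"

fun twist_exp :: "ptree \<Rightarrow> int" where
  "twist_exp Leg = 0"
| "twist_exp (Vertex u) = position_sign u + (\<Sum>t\<leftarrow>u. twist_exp t)"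

text \<open>
  The change of basis that multiplies every tree by the suspension signs of all its vertices. It is
  an involution.
\<close>

definition twist :: "(ptree \<Rightarrow>\<^sub>0 'k::field) \<Rightarrow> ptree \<Rightarrow>\<^sub>0 'k" where
  "twist = lin (\<lambda>t. scale (psign (twist_exp t)) (tree t))"

lemma linear_twist [intro!]: "is_linear twist"
  unfolding twist_def by blast

lemma twist_twist [simp]: "twist (twist f) = f"
  by (simp add: twist_def lin_lin del: scale_single) simp

lemma psign_cong: "even (x - y) \<Longrightarrow> psign x = psign y"
  by (auto simp: psign_def)

lemma position_sign_append:
  "position_sign (u @ v) = position_sign u + int (length v) * wdeg u + position_sign v"
  by (induction u) (simp_all add: algebra_simps)

text \<open>
  The sign of the term of \<open>\<Phi>\<^sub>n\<close> with inner inputs \<open>v\<close> once trees \<open>p\<close> are attached before them: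
  the exponent in \<open>\<Phi>\<^sub>n\<close>, and a Koszul sign for moving the inner corolla, of the parity of
  \<open>length v\<close>, past \<open>p\<close>.
\<close>

definition relation_exp :: "ptree list \<Rightarrow> ptree list \<Rightarrow> int" where
  "relation_exp p v = int (length p) * (int (length v) + 1) + int (length v)
     + int (length v) * (\<Sum>t\<leftarrow>p. deg t)"

text \<open>
  The relation \<open>\<Phi>\<^sub>n\<close> composed with the trees \<open>u\<close> at its \<open>n\<close> inputs.
\<close>

definition relation :: "ptree list \<Rightarrow> ptree \<Rightarrow>\<^sub>0 'k::field" where
  "relation u = infix_sum (\<lambda>p v w. scale (psign (relation_exp p v)) (tree (Vertex (p @ Vertex v # w)))) u"

lemma wdeg_eq: "wdeg u = (\<Sum>t\<leftarrow>u. deg t) + int (length u)"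
  by (induction u) (simp_all add: sdeg_def)

text \<open>
  The exponent of each term, corrected by the suspension signs, is the Koszul exponent \<open>wdeg p\<close> up
  to a summand that depends only on the word \<open>p @ v @ w\<close>.
\<close>

lemma relation_exp_twist:
  "even (twist_exp (Vertex (p @ Vertex v # w)) + relation_exp p v
     - (int (length (p @ v @ w)) + twist_exp (Vertex (p @ v @ w)) + wdeg p))"
proof -
  let ?l = "int (length p)" and ?k = "int (length v)" and ?r = "int (length w)"
  have "twist_exp (Vertex (p @ Vertex v # w)) + relation_exp p v
     - (int (length (p @ v @ w)) + twist_exp (Vertex (p @ v @ w)) + wdeg p)
     = 2 * (- ?r)"
    by (simp add: position_sign_append relation_exp_def wdeg_eq algebra_simps)
  then show ?thesis by (rule ssubst[where P = even]) (rule dvd_triv_left)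
qed

lemma twist_relation:
  "twist (relation u) = scale (psign (int (length u) + twist_exp (Vertex u))) (vert (raw_bar u))"
proof -
  define e where "e = (psign (int (length u) + twist_exp (Vertex u)) :: 'a)"
  have "twist (relation u) = infix_sum (\<lambda>p v w. twist (scale (psign (relation_exp p v))
      (tree (Vertex (p @ Vertex v # w))))) u"
    unfolding relation_def by (rule linear_infix_sum[OF linear_twist])
  also have "\<dots> = infix_sum (\<lambda>p v w. scale e (vert (scale (psign (wdeg p)) (word (p @ Vertex v # w))))) u"
  proof (rule infix_sum_cong)
    fix p v w assume u: "u = p @ v @ w"
    have "psign (twist_exp (Vertex (p @ Vertex v # w)) + relation_exp p v)
        = (psign (int (length u) + twist_exp (Vertex u) + wdeg p) :: 'a)"
      unfolding u by (rule psign_cong) (rule relation_exp_twist)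
    then show "twist (scale (psign (relation_exp p v)) (tree (Vertex (p @ Vertex v # w))))
        = scale e (vert (scale (psign (wdeg p)) (word (p @ Vertex v # w))))"
      by (simp add: twist_def vert_def psign_add e_def mult_ac)
  qed
  also have "\<dots> = scale e (vert (raw_bar u))"
    unfolding raw_bar_eq_infix_sum
    by (simp add: linear_infix_sum[OF linear_vert] linear_infix_sum[OF linear_scale[of e]] del: scale_single)
  finally show ?thesis unfolding e_def .
qed

lemma deg_graft_cong:
  "\<lbrakk>1 \<le> i; i \<le> legs t; even (deg s - deg s')\<rbrakk> \<Longrightarrow> even (sdeg (graft t i s) - sdeg (graft t i s'))"
  by (simp add: sdeg_def deg_graft)

text \<open>
  The twist of a graft differs from that of the grafted tree by a sign that depends only on the
  parity of the degree of the grafted tree: only this parity enters the position signs of the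
  vertices below.
\<close>

lemma twist_exp_graft:
  "\<lbrakk>1 \<le> i; i \<le> legs t; even (deg s - deg s')\<rbrakk> \<Longrightarrow>
     even (twist_exp (graft t i s) + twist_exp s - (twist_exp (graft t i s') + twist_exp s'))"
  "\<lbrakk>1 \<le> i; i \<le> (\<Sum>t\<leftarrow>u. legs t); even (deg s - deg s')\<rbrakk> \<Longrightarrow>
     even (position_sign (graft_forest u i s) - position_sign (graft_forest u i s')) \<and>
     even ((\<Sum>t\<leftarrow>graft_forest u i s. twist_exp t) + twist_exp s
       - ((\<Sum>t\<leftarrow>graft_forest u i s'. twist_exp t) + twist_exp s'))"
proof (induction t i s and u i s rule: graft_graft_forest.induct)
  case (4 t u i s)
  show ?case
  proof (cases "i \<le> legs t")
    case True
    then show ?thesis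
      using 4 deg_graft_cong[of i t s s'] by auto
  next
    case False
    then show ?thesis using 4 by auto
  qed
qed auto

definition homogeneous :: "int \<Rightarrow> nat \<Rightarrow> ptree set" where
  "homogeneous d n = {t. deg t = d \<and> legs t = n}"

lemma even_shift: "even (x + y - z) \<Longrightarrow> even (x - (z + y))" for x y z :: int
  by presburger

lemma twist_plug:
  assumes "f \<in> supp (homogeneous d n)" "1 \<le> i" "i \<le> legs t"
  shows "\<exists>e. twist (plug t i f) = scale (psign e) (plug t i (twist f :: ptree \<Rightarrow>\<^sub>0 'k::field))"
proof (cases "f = 0")
  case True
  then show ?thesis
    by (simp add: Modules.module_hom.zero[OF linear_plug] Modules.module_hom.zero[OF linear_twist])
next
  case False
  then have "Poly_Mapping.keys f \<noteq> {}" by simp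
  then obtain s0 where s0: "s0 \<in> homogeneous d n"
    using assms(1) unfolding supp_def by blast
  define e where "e = twist_exp (graft t i s0) + twist_exp s0"
  have "twist (plug t i f) = lin (\<lambda>s. scale (psign (twist_exp (graft t i s))) (tree (graft t i s))) f"
    by (simp add: plug_def twist_def lin_lin)
  also have "\<dots> = lin (\<lambda>s. scale (psign e) (scale (psign (twist_exp s)) (tree (graft t i s)))) f"
  proof (rule lin_cong_supp[OF assms(1)])
    fix s assume "s \<in> homogeneous d n"
    then have "even (twist_exp (graft t i s) + twist_exp s - e)"
      using twist_exp_graft(1)[OF assms(2,3), of s s0] s0 
      by (simp add: homogeneous_def e_def)
    then have "psign (twist_exp (graft t i s)) = (psign (e + twist_exp s) :: 'k)"
      by (intro psign_cong even_shift)
    then show "scale (psign (twist_exp (graft t i s))) (tree (graft t i s))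
        = scale (psign e) (scale (psign (twist_exp s)) (tree (graft t i s)) :: _ \<Rightarrow>\<^sub>0 'k)"
      by (simp add: psign_add)
  qed
  also have "\<dots> = scale (psign e) (plug t i (twist f))"
    by (simp only: lin_fun_scale) (simp add: plug_def twist_def lin_lin)
  finally show ?thesis ..
qed

lemma koszul_eq: "koszul t i s = psign (deg s * deg_after t i)"
  by (simp add: koszul_def psign_def)

lemma circ_eq_lin:
  "circ f i g = lin (\<lambda>t. lin (\<lambda>s. scale (psign (deg s * deg_after t i)) (tree (graft t i s))) g) f"
  by (simp add: circ_def lin_def pm.scale_sum_right koszul_eq mult.commute mult.left_commute)

lemma linear_circ_left [intro!]: "is_linear (\<lambda>f. circ f i g)"
  unfolding circ_eq_lin by blast

lemma linear_circ_right [intro!]: "is_linear (\<lambda>g. circ f i g)"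
  unfolding circ_eq_lin by (rule is_linearI) (simp_all only: lin_add lin_fun_add lin_scale lin_fun_scale)

lemma circ_tree_eq_plug:
  assumes "f \<in> supp (homogeneous d n)"
  shows "circ (tree t) i f = scale (psign (d * deg_after t i)) (plug t i f)"
proof -
  have "circ (tree t) i f = lin (\<lambda>s. scale (psign (deg s * deg_after t i)) (tree (graft t i s))) f"
    by (simp add: circ_eq_lin)
  also have "\<dots> = lin (\<lambda>s. scale (psign (d * deg_after t i)) (tree (graft t i s))) f"
    by (rule lin_cong_supp[OF assms]) (simp add: homogeneous_def)
  finally show ?thesis by (simp only: lin_fun_scale plug_def)
qed

lemma relation_in_supp:
  "relation u \<in> supp (homogeneous (int (length u) - 3 + (\<Sum>t\<leftarrow>u. deg t)) (\<Sum>t\<leftarrow>u. legs t))"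
  unfolding relation_def
  by (rule infix_sum_in_subspace[OF subspace_supp])
    (auto intro!: supp_scale supp_single simp: homogeneous_def deg_Vertex simp del: scale_single)

lemma twist_circ_relation:
  assumes "1 \<le> i" "i \<le> legs t"
  shows "\<exists>e. twist (circ (tree t) i (relation u))
    = scale (psign e) (plug t i (vert (raw_bar u)) :: ptree \<Rightarrow>\<^sub>0 'k::field)"
proof -
  obtain e where "twist (plug t i (relation u)) = scale (psign e) (plug t i (twist (relation u) :: ptree \<Rightarrow>\<^sub>0 'k))"
    using twist_plug[OF relation_in_supp assms] by blast
  then show ?thesis
    by (auto simp: circ_tree_eq_plug[OF relation_in_supp] twist_relation psign_add[symmetric]
        Modules.module_hom.scale[OF linear_plug] Modules.module_hom.scale[OF linear_twist])
qed

section \<open>The relations under grafting\<close>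

lemma graft_forest_append:
  "1 \<le> i \<Longrightarrow> graft_forest (p @ q) i s =
     (if i \<le> (\<Sum>t\<leftarrow>p. legs t) then graft_forest p i s @ q
      else p @ graft_forest q (i - (\<Sum>t\<leftarrow>p. legs t)) s)"
  by (induction p arbitrary: i) auto

lemma deg_after_forest_append:
  "1 \<le> i \<Longrightarrow> deg_after_forest (p @ q) i =
     (if i \<le> (\<Sum>t\<leftarrow>p. legs t) then deg_after_forest p i + (\<Sum>t\<leftarrow>q. deg t)
      else deg_after_forest q (i - (\<Sum>t\<leftarrow>p. legs t)))"
  by (induction p arbitrary: i) auto

definition relation_term :: "ptree list \<Rightarrow> ptree list \<Rightarrow> ptree list \<Rightarrow> ptree \<Rightarrow>\<^sub>0 'k::field" where
  "relation_term p v w = scale (psign (relation_exp p v)) (tree (Vertex (p @ Vertex v # w)))"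

text \<open>
  The graft goes into one of the three parts of the word. In the first part the sign of the
  relation changes by the parity of \<open>length v\<close> times the degree of \<open>s\<close>; but then \<open>s\<close> also has to
  pass the inner corolla, of degree \<open>length v - 2\<close>, which compensates it.
\<close>

lemma circ_relation_term:
  assumes "1 \<le> i" "i \<le> (\<Sum>t\<leftarrow>p @ v @ w. legs t)"
  obtains p' v' w' where "graft_forest (p @ v @ w) i s = p' @ v' @ w'"
    "length p' = length p" "length v' = length v"
    "circ (relation_term p v w) i (tree s) = scale (psign (deg s * deg_after_forest (p @ v @ w) i))
       (relation_term p' v' w' :: ptree \<Rightarrow>\<^sub>0 'k::field)"
proof -
  let ?D = "deg_after_forest (p @ Vertex v # w) i"
  have circ: "circ (relation_term p v w) i (tree s)
      = scale (psign (relation_exp p v + deg s * ?D)) (tree (graft (Vertex (p @ Vertex v # w)) i s) :: _ \<Rightarrow>\<^sub>0 'k)"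
    by (simp add: relation_term_def Modules.module_hom.scale[OF linear_circ_left] circ_single
        koszul_eq psign_add mult_ac)
  have "\<exists>p' v' w'. graft_forest (p @ v @ w) i s = p' @ v' @ w' \<and>
      graft_forest (p @ Vertex v # w) i s = p' @ Vertex v' # w' \<and>
      length p' = length p \<and> length v' = length v \<and>
      even (relation_exp p v + deg s * ?D
        - (deg s * deg_after_forest (p @ v @ w) i + relation_exp p' v'))"
  proof -
    consider "i \<le> (\<Sum>t\<leftarrow>p. legs t)"
      | "(\<Sum>t\<leftarrow>p. legs t) < i" "i \<le> (\<Sum>t\<leftarrow>p @ v. legs t)" | "(\<Sum>t\<leftarrow>p @ v. legs t) < i"
      by linarith
    then show ?thesis
    proof cases
      case 1
      have e1: "relation_exp (graft_forest p i s) v = relation_exp p v + int (length v) * deg s"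
        using deg_graft(2)[of i p s] 1 assms by (simp add: relation_exp_def algebra_simps)
      have e2: "?D = deg_after_forest (p @ v @ w) i + int (length v) - 2"
        using 1 assms by (simp add: deg_after_forest_append deg_Vertex)
      have "relation_exp p v + deg s * ?D
        - (deg s * deg_after_forest (p @ v @ w) i + relation_exp (graft_forest p i s) v)
        = 2 * (- deg s)" unfolding e1 e2 by (simp add: algebra_simps)
      then have "even (relation_exp p v + deg s * ?D
        - (deg s * deg_after_forest (p @ v @ w) i + relation_exp (graft_forest p i s) v))"
        by (rule ssubst[where P = even]) (rule dvd_triv_left)
      moreover have "graft_forest (p @ v @ w) i s = graft_forest p i s @ v @ w"
        "graft_forest (p @ Vertex v # w) i s = graft_forest p i s @ Vertex v # w"
        using 1 assms by (simp_all add: graft_forest_append)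
      ultimately show ?thesis
        using length_graft_forest by blast
    next
      case 2
      let ?i = "i - (\<Sum>t\<leftarrow>p. legs t)"
      have i: "1 \<le> ?i" "?i \<le> (\<Sum>t\<leftarrow>v. legs t)" using 2 by auto
      have "graft_forest (p @ v @ w) i s = p @ graft_forest v ?i s @ w"
        "graft_forest (p @ Vertex v # w) i s = p @ Vertex (graft_forest v ?i s) # w"
        "deg_after_forest (p @ Vertex v # w) i = deg_after_forest (p @ v @ w) i"
        "relation_exp p (graft_forest v ?i s) = relation_exp p v"
        using 2 assms i
        by (simp_all add: graft_forest_append deg_after_forest_append relation_exp_def)
      then show ?thesis
        using length_graft_forest by (metis add.commute dvd_0_right diff_self)
    next
      case 3
      let ?i = "i - (\<Sum>t\<leftarrow>p @ v. legs t)"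
      have i: "\<not> i - (\<Sum>t\<leftarrow>p. legs t) \<le> (\<Sum>t\<leftarrow>v. legs t)" "\<not> i \<le> (\<Sum>t\<leftarrow>p. legs t)"
        using 3 by auto
      have "graft_forest (p @ v @ w) i s = p @ v @ graft_forest w ?i s"
        "graft_forest (p @ Vertex v # w) i s = p @ Vertex v # graft_forest w ?i s"
        "deg_after_forest (p @ Vertex v # w) i = deg_after_forest (p @ v @ w) i"
        using 3 assms i by (simp_all add: graft_forest_append deg_after_forest_append)
      then show ?thesis
        by (metis add.commute dvd_0_right diff_self)
    qed
  qed
  then obtain p' v' w' where *: "graft_forest (p @ v @ w) i s = p' @ v' @ w'"
      "graft_forest (p @ Vertex v # w) i s = p' @ Vertex v' # w'"
      "length p' = length p" "length v' = length v"
      "even (relation_exp p v + deg s * ?D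
        - (deg s * deg_after_forest (p @ v @ w) i + relation_exp p' v'))"
    by blast
  have "circ (relation_term p v w) i (tree s) = scale (psign (deg s * deg_after_forest (p @ v @ w) i))
       (relation_term p' v' w' :: ptree \<Rightarrow>\<^sub>0 'k)"
    unfolding circ using psign_cong[OF *(5), where ?'a = 'k] *(2)
    by (simp add: relation_term_def psign_add)
  with * that show ?thesis by blast
qed

lemma relation_eq_sum:
  "relation u = (\<Sum>l<length u. \<Sum>k\<in>{1..length u - l}.
     relation_term (take l u) (take k (drop l u)) (drop (l + k) u))"
  unfolding relation_def relation_term_def infix_sum_eq_sum ..

text \<open>
  Grafting into a relation only changes the trees attached to it, up to a common sign. This is why
  the grafted relations are closed under composition from the right.
\<close>

lemma circ_relation:
  assumes "1 \<le> i" "i \<le> (\<Sum>t\<leftarrow>u. legs t)"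
  shows "circ (relation u) i (tree s)
    = scale (psign (deg s * deg_after_forest u i)) (relation (graft_forest u i s) :: ptree \<Rightarrow>\<^sub>0 'k::field)"
proof -
  let ?u = "graft_forest u i s"
  have "circ (relation_term (take l u) (take k (drop l u)) (drop (l + k) u)) i (tree s)
      = scale (psign (deg s * deg_after_forest u i))
        (relation_term (take l ?u) (take k (drop l ?u)) (drop (l + k) ?u) :: _ \<Rightarrow>\<^sub>0 'k)"
    if lk: "l < length u" "k \<in> {1..length u - l}" for l k
  proof -
    let ?p = "take l u" and ?v = "take k (drop l u)" and ?w = "drop (l + k) u"
    have u: "u = ?p @ ?v @ ?w"
      by (metis add.commute append_take_drop_id drop_drop)
    obtain p' v' w' where *: "graft_forest (?p @ ?v @ ?w) i s = p' @ v' @ w'"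
      "length p' = length ?p" "length v' = length ?v"
      "circ (relation_term ?p ?v ?w) i (tree s) = scale (psign (deg s * deg_after_forest (?p @ ?v @ ?w) i))
       (relation_term p' v' w' :: _ \<Rightarrow>\<^sub>0 'k)"
      by (rule circ_relation_term[of i ?p ?v ?w s]) (use assms u in auto)
    then have "p' = take l ?u" "v' = take k (drop l ?u)" "w' = drop (l + k) ?u"
      using lk u by auto
    then show ?thesis using *(4) u by simp
  qed
  then show ?thesis
    unfolding relation_eq_sum Modules.module_hom.sum[OF linear_circ_left]
    by (simp add: pm.scale_sum_right)
qed

lemma Phi_eq_relation:
  assumes "1 \<le> n"
  shows "Phi n = relation (replicate n Leg)"
proof -
  have "Poly_Mapping.map ((*) ((-1) ^ (l * (k + 1) + k))) (circ (xi (n - k + 1)) (l + 1) (xi k))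
      = (relation_term (take l (replicate n Leg)) (take k (drop l (replicate n Leg)))
          (drop (l + k) (replicate n Leg)) :: _ \<Rightarrow>\<^sub>0 'a)"
    if "l < n" "k \<in> {1..n - l}" for l k
  proof -
    have r: "replicate (n - k + 1) Leg = replicate l Leg @ Leg # replicate (n - (l + k)) Leg"
    proof -
      have "n - k + 1 = l + Suc (n - (l + k))" using that by auto
      then show ?thesis by (simp only: replicate_add replicate_Suc)
    qed
    have "circ (xi (n - k + 1)) (l + 1) (xi k)
        = (tree (Vertex (replicate l Leg @ Vertex (replicate k Leg) # replicate (n - (l + k)) Leg)) :: _ \<Rightarrow>\<^sub>0 'a)"
      unfolding xi_def r
      using circ_attach_subtree[of "replicate (n - (l + k)) Leg" "replicate l Leg" "Vertex (replicate k Leg)"]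
      by (simp add: sum_list_replicate)
    moreover have "(-1) ^ (l * (k + 1) + k) = (psign (relation_exp (replicate l Leg) (replicate k Leg)) :: 'a)"
      by (cases "even l"; cases "even k")
        (simp_all add: psign_def relation_exp_def sum_list_replicate)
    ultimately show ?thesis
      using that by (simp add: relation_term_def scale_def[symmetric] min_def)
  qed
  moreover have "{0..n - 1} = {..<n}" using assms by auto
  ultimately show ?thesis
    unfolding Phi_def relation_eq_sum by (intro sum.cong) auto
qed

section \<open>The operadic ideal\<close>

text \<open>
  With the relations already composed with trees at their inputs, trees below them suffice to obtain
  the whole ideal.
\<close>

definition relators :: "enat \<Rightarrow> nat \<Rightarrow> (ptree \<Rightarrow>\<^sub>0 'k::field) set" where
  "relators m n = {circ (tree t) i (relation u) | t i u. bounded m t \<and> 1 \<le> i \<and> i \<le> legs t \<and>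
     bounded m (Vertex u) \<and> legs t + legs (Vertex u) = n + 1}"

lemma circ_trees: "circ (tree t) i (tree s) = scale (koszul t i s) (tree (graft t i s))"
  by (simp add: circ_single)

lemma koszul_sq [simp]: "koszul t i s * koszul t i s = 1"
  by (simp add: koszul_eq)

lemma circ_circ_sequential:
  assumes "1 \<le> i" "i \<le> legs t" "1 \<le> j" "j \<le> legs s"
  shows "circ (circ (tree t) i (tree s)) (i + j - 1) f
    = circ (tree t) i (circ (tree s) j f :: ptree \<Rightarrow>\<^sub>0 'k::field)"
  by (rule linear_ext[OF linear_circ_right linear_comp[OF linear_circ_right linear_circ_right]])
    (rule circ_sequential[OF assms])

lemma circ_circ_inner:
  assumes "f \<in> supp (homogeneous d n)" "1 \<le> i" "i \<le> legs t" "1 \<le> j" "j \<le> n"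
  shows "circ (circ (tree t) i f) (i + j - 1) (tree u)
    = circ (tree t) i (circ f j (tree u) :: ptree \<Rightarrow>\<^sub>0 'k::field)"
proof (rule linear_ext[where L = "\<lambda>f. circ (circ (tree t) i f) (i + j - 1) (tree u)"
      and M = "\<lambda>f. circ (tree t) i (circ f j (tree u))"])
  fix s assume "s \<in> Poly_Mapping.keys f"
  then have "j \<le> legs s" using assms by (auto simp: supp_def homogeneous_def)
  then show "circ (circ (tree t) i (tree s)) (i + j - 1) (tree u)
      = (circ (tree t) i (circ (tree s) j (tree u)) :: ptree \<Rightarrow>\<^sub>0 'k)"
    using assms by (intro circ_sequential) auto
qed (auto intro!: linear_comp[OF linear_circ_left] linear_comp[OF linear_circ_right])

lemma circ_circ_parallel_left:
  assumes "f \<in> supp (homogeneous d n)" "1 \<le> i" "i < k" "k \<le> legs t"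
  shows "circ (circ (tree t) k f) i (tree s)
    = scale (psign (deg s * d)) (circ (circ (tree t) i (tree s)) (k + legs s - 1) f :: ptree \<Rightarrow>\<^sub>0 'k::field)"
proof (rule linear_ext[where L = "\<lambda>f. circ (circ (tree t) k f) i (tree s)"
      and M = "\<lambda>f. scale (psign (deg s * d)) (circ (circ (tree t) i (tree s)) (k + legs s - 1) f)"])
  fix x assume "x \<in> Poly_Mapping.keys f"
  then have x: "deg x = d" using assms by (auto simp: supp_def homogeneous_def)
  have "circ (circ (tree t) i (tree s)) (k + legs s - 1) (tree x)
      = scale (psign (deg s * d)) (circ (circ (tree t) k (tree x)) i (tree s) :: ptree \<Rightarrow>\<^sub>0 'k)"
    using circ_parallel[OF assms(2-4), of s x] by (simp add: scale_def psign_def x)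
  then show "circ (circ (tree t) k (tree x)) i (tree s)
      = scale (psign (deg s * d)) (circ (circ (tree t) i (tree s)) (k + legs s - 1) (tree x) :: ptree \<Rightarrow>\<^sub>0 'k)"
    by simp
qed (auto intro!: linear_comp[OF linear_circ_left] linear_comp[OF linear_circ_right] linear_comp[OF linear_scale])

lemma circ_circ_parallel_right:
  assumes "f \<in> supp (homogeneous d n)" "1 \<le> i" "i < k" "k \<le> legs t"
  shows "circ (circ (tree t) i f) (k + n - 1) (tree u)
    = scale (psign (d * deg u)) (circ (circ (tree t) k (tree u)) i f :: ptree \<Rightarrow>\<^sub>0 'k::field)"
proof (rule linear_ext[where L = "\<lambda>f. circ (circ (tree t) i f) (k + n - 1) (tree u)"
      and M = "\<lambda>f. scale (psign (d * deg u)) (circ (circ (tree t) k (tree u)) i f)"])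
  fix x assume "x \<in> Poly_Mapping.keys f"
  then have x: "deg x = d" "legs x = n" using assms by (auto simp: supp_def homogeneous_def)
  show "circ (circ (tree t) i (tree x)) (k + n - 1) (tree u)
      = scale (psign (d * deg u)) (circ (circ (tree t) k (tree u)) i (tree x) :: ptree \<Rightarrow>\<^sub>0 'k)"
    using circ_parallel[OF assms(2-4), of x u] by (simp add: scale_def psign_def x)
qed (auto intro!: linear_comp[OF linear_circ_left] linear_comp[OF linear_circ_right] linear_comp[OF linear_scale])

lemma circ_in_span_relators:
  assumes "bounded m t" "1 \<le> i" "i \<le> legs t" "bounded m (Vertex u)"
    "legs t + legs (Vertex u) = n + 1"
  shows "circ (tree t) i (relation u) \<in> pm.span (relators m n)"
  using assms unfolding relators_def by (intro pm.span_base) blast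

lemma circ_graft_in_span_relators:
  assumes "bounded m (graft t j s)" "1 \<le> i" "i \<le> legs (graft t j s)" "bounded m (Vertex u)"
    "legs (graft t j s) + legs (Vertex u) = n + 1"
  shows "circ (circ (tree t) j (tree s)) i (relation u) \<in> pm.span (relators m n)"
  unfolding circ_trees Modules.module_hom.scale[OF linear_circ_left]
  by (intro pm.span_scale circ_in_span_relators assms)

lemma circ_tree_relation_graft:
  assumes "bounded m t" "1 \<le> i" "i \<le> legs t" "g \<in> relators m n"
  shows "circ (tree t) i g \<in> pm.span (relators m (legs t + n - 1))"
proof -
  obtain s j u where g: "g = circ (tree s) j (relation u)" "bounded m s" "1 \<le> j" "j \<le> legs s"
    "bounded m (Vertex u)" "legs s + legs (Vertex u) = n + 1"
    using assms(4) unfolding relators_def by blast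
  show ?thesis
    unfolding g(1) circ_circ_sequential[OF assms(2,3) g(3,4), symmetric]
    using legs_graft(1)[OF assms(2,3), of s] assms g
    by (intro circ_graft_in_span_relators bounded_graft) auto
qed

lemma bounded_graft_forest:
  assumes "bounded m (Vertex u)" "bounded m s"
  shows "bounded m (Vertex (graft_forest u i s))"
  using bounded_graft[OF assms, of i] by simp

text \<open>
  The leg into which \<open>s\<close> is grafted lies to the left of the relation, above it, or to its right.
\<close>

lemma circ_relation_graft_tree:
  assumes "g \<in> relators m n" "bounded m s" "1 \<le> i" "i \<le> n"
  shows "circ g i (tree s) \<in> pm.span (relators m (n + legs s - 1))"
proof -
  obtain t j u where g: "g = circ (tree t) j (relation u)" "bounded m t" "1 \<le> j" "j \<le> legs t"
    "bounded m (Vertex u)" "legs t + legs (Vertex u) = n + 1"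
    using assms(1) unfolding relators_def by blast
  let ?n = "\<Sum>t\<leftarrow>u. legs t"
  consider "i < j" | "j \<le> i" "i \<le> j + ?n - 1" | "j + ?n - 1 < i" by linarith
  then show ?thesis
  proof cases
    case 1
    have "circ (circ (tree t) i (tree s)) (j + legs s - 1) (relation u)
        \<in> pm.span (relators m (n + legs s - 1))"
      using legs_graft(1)[of i t s] assms g 1
      by (intro circ_graft_in_span_relators bounded_graft) auto
    then show ?thesis
      unfolding g(1) circ_circ_parallel_left[OF relation_in_supp assms(3) 1 g(4)]
      by (rule pm.span_scale)
  next
    case 2
    have i: "i = j + (i - j + 1) - 1" "1 \<le> i - j + 1" "i - j + 1 \<le> ?n"
      using 2 g(3) by auto
    have "circ g i (tree s) = circ (tree t) j (circ (relation u) (i - j + 1) (tree s))"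
      unfolding g(1) using circ_circ_inner[OF relation_in_supp g(3,4) i(2,3)] i(1) by simp
    also have "\<dots> \<in> pm.span (relators m (n + legs s - 1))"
      unfolding circ_relation[OF i(2,3)] Modules.module_hom.scale[OF linear_circ_right]
      using legs_graft(2)[OF i(2,3), of s] g assms
      by (intro pm.span_scale circ_in_span_relators bounded_graft_forest) auto
    finally show ?thesis .
  next
    case 3
    obtain k where k: "i = k + ?n - 1" "j < k" "k \<le> legs t"
      using that[of "i - ?n + 1"] 3 g assms by auto
    have "circ g i (tree s) = scale (psign ((int (length u) - 3 + (\<Sum>t\<leftarrow>u. deg t)) * deg s))
        (circ (circ (tree t) k (tree s)) j (relation u))"
      unfolding g(1) k(1) by (rule circ_circ_parallel_right[OF relation_in_supp g(3) k(2,3)])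
    also have "\<dots> \<in> pm.span (relators m (n + legs s - 1))"
      using legs_graft(1)[of k t s] assms g k
      by (intro pm.span_scale circ_graft_in_span_relators bounded_graft) auto
    finally show ?thesis .
  qed
qed

lemma tree_space_simps [simp]:
  "carrier (tree_space S) = supp S" "add (tree_space S) = (+)" "zero (tree_space S) = 0"
  "module.smult (tree_space S) = scale"
  by (auto simp: tree_space_def supp_def scale_def fun_eq_iff)

lemma subspace_tree_space_iff:
  "subspace class_ring W (tree_space S :: ('k::field, ptree \<Rightarrow>\<^sub>0 'k) module)
     \<longleftrightarrow> pm.subspace W \<and> W \<subseteq> supp S"
proof -
  have "vectorspace class_ring (tree_space S :: ('k, ptree \<Rightarrow>\<^sub>0 'k) module)"
    by (rule vectorspace_tree_space)
  then show ?thesis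
    by (auto simp: VectorSpace.subspace_def submodule_def vectorspace_def pm.subspace_def)
qed

lemma circ_in_supp:
  assumes "f \<in> supp (ntrees m n)" "g \<in> supp (ntrees m n')" "1 \<le> i" "i \<le> n"
  shows "circ f i g \<in> supp (ntrees m (n + n' - 1))"
  unfolding circ_eq_lin
  by (intro lin_in_supp[OF assms(1)] lin_in_supp[OF assms(2)] supp_scale supp_single
      graft_in_ntrees assms)

lemma relation_in_supp_ntrees:
  assumes "bounded m (Vertex u)"
  shows "relation u \<in> supp (ntrees m (legs (Vertex u)))"
  unfolding relation_def
proof (rule infix_sum_in_subspace[OF subspace_supp])
  fix p v w assume u: "u = p @ v @ w" "v \<noteq> []"
  have "enat (length v) \<le> m" "enat (length (p @ Vertex v # w)) \<le> m"
    using assms u by (auto intro: order_trans[rotated, of "enat (length u)"] simp: Suc_le_eq)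
  then show "scale (psign (relation_exp p v)) (tree (Vertex (p @ Vertex v # w)))
      \<in> supp (ntrees m (legs (Vertex u)))"
    using assms u by (intro supp_scale supp_single) (auto simp: ntrees_iff)
qed

lemma legs_pos: "bounded m t \<Longrightarrow> 1 \<le> legs t"
proof (induction t)
  case (Vertex u)
  then obtain t v where "u = t # v" by (cases u) auto
  then show ?case using Vertex by (auto intro: trans_le_add1)
qed simp

lemma relators_subset_supp: "relators m n \<subseteq> supp (ntrees m n)"
proof
  fix g assume "g \<in> relators m n"
  then obtain s j u where g: "g = circ (tree s) j (relation u)" "bounded m s" "1 \<le> j" "j \<le> legs s"
    "bounded m (Vertex u)" "legs s + legs (Vertex u) = n + 1"
    unfolding relators_def by blast
  then have "g \<in> supp (ntrees m (legs s + legs (Vertex u) - 1))"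
    unfolding g(1)
    by (intro circ_in_supp[OF supp_single relation_in_supp_ntrees]) (simp_all add: ntrees_iff)
  then show "g \<in> supp (ntrees m n)" using g(6) by simp
qed

lemma operadic_ideal_span: "operadic_ideal m (\<lambda>n. pm.span (relators m n))"
  unfolding operadic_ideal_def free_operad_def tree_space_simps
proof (intro conjI allI impI ballI)
  fix n
  show "subspace class_ring (pm.span (relators m n)) (tree_space (ntrees m n))"
    unfolding subspace_tree_space_iff
    by (auto intro!: pm.span_minimal[OF relators_subset_supp subspace_supp, THEN subsetD])
next
  fix n n' i and f g :: "ptree \<Rightarrow>\<^sub>0 'k::field"
  assume i: "i \<in> {1..n}" and f: "f \<in> supp (ntrees m n)" and g: "g \<in> supp (ntrees m n')"
    and "f \<in> pm.span (relators m n) \<or> g \<in> pm.span (relators m n')"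
  then consider "f \<in> pm.span (relators m n)" | "g \<in> pm.span (relators m n')" by blast
  then show "circ f i g \<in> pm.span (relators m (n + n' - 1))"
  proof cases
    case 1
    then show ?thesis
    proof (induction rule: pm.span_induct_alt)
      case base
      then show ?case by (simp add: Modules.module_hom.zero[OF linear_circ_left] pm.span_zero)
    next
      case (step a x y)
      have "circ x i g = lin (\<lambda>s. circ x i (tree s)) g"
        by (rule linear_eq_lin[OF linear_circ_right])
      also have "\<dots> \<in> pm.span (relators m (n + n' - 1))"
      proof (rule lin_in_subspace[OF pm.subspace_span])
        fix s assume "s \<in> Poly_Mapping.keys g"
        then have "bounded m s" "legs s = n'" using g by (auto simp: supp_def ntrees_iff)
        then show "circ x i (tree s) \<in> pm.span (relators m (n + n' - 1))"
          using circ_relation_graft_tree[OF step(1), of s i] i by simp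
      qed
      finally show ?case
        using step by (simp add: Modules.module_hom.add[OF linear_circ_left]
            Modules.module_hom.scale[OF linear_circ_left] pm.span_add pm.span_scale)
    qed
  next
    case 2
    then show ?thesis
    proof (induction rule: pm.span_induct_alt)
      case base
      then show ?case by (simp add: Modules.module_hom.zero[OF linear_circ_right] pm.span_zero)
    next
      case (step a x y)
      have "circ f i x = lin (\<lambda>t. circ (tree t) i x) f"
        by (rule linear_eq_lin[OF linear_circ_left])
      also have "\<dots> \<in> pm.span (relators m (n + n' - 1))"
      proof (rule lin_in_subspace[OF pm.subspace_span])
        fix t assume "t \<in> Poly_Mapping.keys f"
        then have "bounded m t" "legs t = n" using f by (auto simp: supp_def ntrees_iff)
        then show "circ (tree t) i x \<in> pm.span (relators m (n + n' - 1))"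
          using circ_tree_relation_graft[OF _ _ _ step(1), of t i] i by simp
      qed
      finally show ?case
        using step by (simp add: Modules.module_hom.add[OF linear_circ_right]
            Modules.module_hom.scale[OF linear_circ_right] pm.span_add pm.span_scale)
    qed
  qed
qed

lemma Phi_in_span:
  assumes "1 \<le> k" "enat k \<le> m"
  shows "Phi k \<in> pm.span (relators m k)"
proof -
  have "Phi k = circ (tree Leg) 1 (relation (replicate k Leg))"
    unfolding Phi_eq_relation[OF assms(1)] circ_tree_eq_plug[OF relation_in_supp]
    by (simp add: plug_def)
  also have "\<dots> \<in> pm.span (relators m k)"
    using assms by (intro circ_in_span_relators) (auto simp: sum_list_replicate)
  finally show ?thesis .
qed

lemma ideal_circ:
  assumes "operadic_ideal m J" "f \<in> supp (ntrees m n)" "g \<in> supp (ntrees m n')"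
    "1 \<le> n'" "1 \<le> i" "i \<le> n" "f \<in> J n \<or> g \<in> J n'"
  shows "circ f i g \<in> J (n + n' - 1)"
  using assms unfolding operadic_ideal_def free_operad_def tree_space_simps by auto

lemma ideal_subspace:
  assumes "operadic_ideal m J" "1 \<le> n"
  shows "pm.subspace (J n)"
  using assms unfolding operadic_ideal_def free_operad_def subspace_tree_space_iff by auto

text \<open>
  The trees are grafted into the legs of \<open>\<Phi>\<^sub>n\<close> from left to right.
\<close>

lemma relation_in_ideal:
  assumes J: "operadic_ideal m (J :: nat \<Rightarrow> (ptree \<Rightarrow>\<^sub>0 'k::field) set)"
    and Phi: "\<And>k. \<lbrakk>1 \<le> k; enat k \<le> m\<rbrakk> \<Longrightarrow> Phi k \<in> J k"
    and "bounded m (Vertex (u @ replicate j Leg))"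
  shows "relation (u @ replicate j Leg) \<in> J (legs (Vertex (u @ replicate j Leg)))"
  using assms(3)
proof (induction u arbitrary: j rule: rev_induct)
  case Nil
  then show ?case
    using Phi[of j] Phi_eq_relation[of j, where ?'a = 'k]
    by (cases j) (auto simp: sum_list_replicate)
next
  case (snoc t u)
  let ?u = "u @ replicate (Suc j) Leg" and ?i = "(\<Sum>t\<leftarrow>u. legs t) + 1"
  have bounded: "bounded m (Vertex ?u)" "bounded m t"
    using snoc.prems by auto
  have u: "graft_forest ?u ?i t = (u @ [t]) @ replicate j Leg"
    using graft_forest_insert[of u "replicate j Leg" t] by simp
  have i: "1 \<le> ?i" "?i \<le> (\<Sum>t\<leftarrow>?u. legs t)" by auto
  have legs_u: "1 \<le> legs t"
    using bounded legs_pos by blast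
  have "circ (relation ?u) ?i (tree t) \<in> J (legs (Vertex ?u) + legs t - 1)"
    using i legs_u bounded snoc.IH[OF bounded(1)]
    by (intro ideal_circ[OF J] relation_in_supp_ntrees) (auto intro!: supp_single simp: ntrees_iff)
  then have "scale (psign (deg t * deg_after_forest ?u ?i)) (relation (graft_forest ?u ?i t))
      \<in> J (legs (Vertex ((u @ [t]) @ replicate j Leg)))"
    unfolding circ_relation[OF i] by (simp add: add_ac)
  moreover have "pm.subspace (J (legs (Vertex ((u @ [t]) @ replicate j Leg))))"
    using legs_pos[OF snoc.prems] by (intro ideal_subspace[OF J])
  ultimately have "scale (psign (deg t * deg_after_forest ?u ?i))
      (scale (psign (deg t * deg_after_forest ?u ?i)) (relation (graft_forest ?u ?i t)))
      \<in> J (legs (Vertex ((u @ [t]) @ replicate j Leg)))"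
    by (rule pm.subspace_scale[rotated])
  then show ?case unfolding u by simp
qed

lemma A_ideal_eq_span:
  assumes "1 \<le> n"
  shows "A_ideal m n = (pm.span (relators m n) :: (ptree \<Rightarrow>\<^sub>0 'k::field) set)"
proof
  show "A_ideal m n \<subseteq> (pm.span (relators m n) :: (ptree \<Rightarrow>\<^sub>0 'k) set)"
    unfolding A_ideal_def using operadic_ideal_span Phi_in_span by blast
  have "pm.span (relators m n) \<subseteq> J n"
    if J: "operadic_ideal m (J :: nat \<Rightarrow> (ptree \<Rightarrow>\<^sub>0 'k) set)"
      "\<And>k. \<lbrakk>1 \<le> k; enat k \<le> m\<rbrakk> \<Longrightarrow> Phi k \<in> J k" for J
  proof (rule pm.span_minimal[OF _ ideal_subspace[OF J(1) assms]])
    show "relators m n \<subseteq> J n"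
    proof
      fix g :: "ptree \<Rightarrow>\<^sub>0 'k" assume "g \<in> relators m n"
      then obtain s j u where g: "g = circ (tree s) j (relation u)" "bounded m s" "1 \<le> j" "j \<le> legs s"
        "bounded m (Vertex u)" "legs s + legs (Vertex u) = n + 1"
        unfolding relators_def by blast
      have "circ (tree s) j (relation u) \<in> J (legs s + legs (Vertex u) - 1)"
        using relation_in_ideal[OF J, of u 0] g legs_pos[OF g(5)]
        by (intro ideal_circ[OF J(1)] relation_in_supp_ntrees)
          (auto intro!: supp_single simp: ntrees_iff)
      then show "g \<in> J n" using g by simp
    qed
  qed
  then show "(pm.span (relators m n) :: (ptree \<Rightarrow>\<^sub>0 'k) set) \<subseteq> A_ideal m n"
    unfolding A_ideal_def by blast
qed

section \<open>Normal forms modulo the ideal\<close>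

text \<open>
  \<open>NF\<close> in the original signs.
\<close>

definition normalize :: "(ptree \<Rightarrow>\<^sub>0 'k::field) \<Rightarrow> ptree \<Rightarrow>\<^sub>0 'k" where
  "normalize f = twist (lin NF (twist f))"

lemma linear_normalize: "is_linear normalize"
  unfolding normalize_def by (intro linear_comp[OF linear_twist] linear_comp[OF linear_lin] linear_twist)

lemma twist_in_supp: "f \<in> supp A \<Longrightarrow> twist f \<in> supp A"
  unfolding twist_def by (rule lin_in_supp) (auto intro: supp_scale supp_single simp del: scale_single)

lemma normalize_in_supp_Adm:
  assumes "1 \<le> m" "f \<in> supp (ntrees m n)"
  shows "normalize f \<in> supp (Adm m n)"
  unfolding normalize_def
  by (intro twist_in_supp lin_in_supp[OF twist_in_supp[OF assms(2)]])
    (use NF_in_supp_Adm(1)[OF assms(1)] in \<open>auto simp: ntrees_iff\<close>)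

lemma normalize_Adm:
  assumes "f \<in> supp (Adm m n)"
  shows "normalize f = f"
proof -
  have "lin NF (twist f) = lin (\<lambda>t. tree t) (twist f)"
    by (rule lin_cong_supp[OF twist_in_supp[OF assms]]) (auto simp: Adm_iff intro: NF_admissible)
  then show ?thesis by (simp add: normalize_def)
qed

lemma normalize_relators:
  assumes "f \<in> pm.span (relators m n)"
  shows "normalize f = 0"
  using assms
proof (induction rule: pm.span_induct_alt)
  case base
  show ?case by (rule Modules.module_hom.zero[OF linear_normalize])
next
  case (step a x y)
  obtain t i u where x: "x = circ (tree t) i (relation u)" "1 \<le> i" "i \<le> legs t"
    using step(1) unfolding relators_def by blast
  obtain e where e: "twist x = scale (psign e) (plug t i (vert (raw_bar u)))"
    using twist_circ_relation[OF x(2,3)] x(1) by blast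
  have "normalize x = 0"
    unfolding normalize_def e lin_scale NF_plug[OF x(2,3) NF_relator]
    by (simp add: Modules.module_hom.zero[OF linear_twist])
  then show ?case
    using step by (simp add: Modules.module_hom.add[OF linear_normalize]
        Modules.module_hom.scale[OF linear_normalize])
qed

lemma twist_span_twisted_relators:
  assumes "f \<in> pm.span (twisted_relators m n)"
  shows "twist f \<in> pm.span (relators m n)"
  using assms
proof (induction rule: pm.span_induct_alt)
  case base
  show ?case by (simp add: Modules.module_hom.zero[OF linear_twist] pm.span_zero)
next
  case (step a x y)
  obtain t i u where x: "x = plug t i (vert (raw_bar u))" "bounded m t" "1 \<le> i" "i \<le> legs t"
      "bounded m (Vertex u)" "legs t + legs (Vertex u) = n + 1"
    using step(1) unfolding twisted_relators_def by blast
  obtain e where "twist (circ (tree t) i (relation u)) = scale (psign e) x"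
    using twist_circ_relation[OF x(3,4)] x(1) by blast
  then have "twist (twist (circ (tree t) i (relation u))) = scale (psign e) (twist x)"
    by (simp only: Modules.module_hom.scale[OF linear_twist])
  then have "scale (psign e) (circ (tree t) i (relation u)) = scale (psign e) (scale (psign e) (twist x))"
    by simp
  then have "twist x = scale (psign e) (circ (tree t) i (relation u))"
    by simp
  then have "twist x \<in> pm.span (relators m n)"
    using x by (auto intro!: pm.span_scale circ_in_span_relators)
  then show ?case
    using step by (simp add: Modules.module_hom.add[OF linear_twist]
        Modules.module_hom.scale[OF linear_twist] pm.span_add pm.span_scale)
qed

lemma A_ideal_eq_kernel:
  assumes "1 \<le> m" "1 \<le> n"
  shows "A_ideal m n = {f \<in> supp (ntrees m n). normalize f = (0 :: ptree \<Rightarrow>\<^sub>0 'k::field)}"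
proof -
  have "f \<in> pm.span (relators m n)"
    if f: "f \<in> supp (ntrees m n)" "normalize f = (0 :: ptree \<Rightarrow>\<^sub>0 'k)" for f
  proof -
    have "twist (normalize f) = lin NF (twist f)"
      by (simp add: normalize_def)
    then have "lin NF (twist f) = 0"
      by (simp add: f(2) Modules.module_hom.zero[OF linear_twist])
    then have "twist f = lin (\<lambda>t. tree t - NF t) (twist f)"
      by (simp add: lin_fun_diff)
    also have "\<dots> \<in> pm.span (twisted_relators m n)"
    proof (rule lin_in_subspace[OF pm.subspace_span])
      fix t assume "t \<in> Poly_Mapping.keys (twist f)"
      then have "bounded m t" "legs t = n"
        using twist_in_supp[OF f(1)] by (auto simp: supp_def ntrees_iff)
      then show "tree t - NF t \<in> (pm.span (twisted_relators m n) :: (ptree \<Rightarrow>\<^sub>0 'k) set)"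
        using NF_congruent[OF assms(1)] by blast
    qed
    finally have "twist (twist f) \<in> pm.span (relators m n)"
      by (rule twist_span_twisted_relators)
    then show ?thesis by simp
  qed
  moreover have "pm.span (relators m n) \<subseteq> (supp (ntrees m n) :: (ptree \<Rightarrow>\<^sub>0 'k) set)"
    by (rule pm.span_minimal[OF relators_subset_supp subspace_supp])
  ultimately show ?thesis
    unfolding A_ideal_eq_span[OF assms(2)] using normalize_relators by blast
qed

section \<open>The quotient by the kernel of a projection\<close>

text \<open>
  If a subspace is the kernel of a projection onto the span of \<open>A\<close>, then every coset contains
  exactly one element of this span, so the cosets of the trees in \<open>A\<close> form a basis.
\<close>

locale tree_projection =
  fixes S A :: "ptree set" and p :: "(ptree \<Rightarrow>\<^sub>0 'k::field) \<Rightarrow> ptree \<Rightarrow>\<^sub>0 'k"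
  assumes linear: "is_linear p"
    and subset: "A \<subseteq> S"
    and in_supp: "f \<in> supp S \<Longrightarrow> p f \<in> supp A"
    and fixes_supp: "f \<in> supp A \<Longrightarrow> p f = f"
begin

definition kernel :: "(ptree \<Rightarrow>\<^sub>0 'k) set" where
  "kernel = {f \<in> supp S. p f = 0}"

definition quotient :: "('k, (ptree \<Rightarrow>\<^sub>0 'k) set) module" where
  "quotient = quotient_module (tree_space S) kernel"

definition coset :: "(ptree \<Rightarrow>\<^sub>0 'k) \<Rightarrow> (ptree \<Rightarrow>\<^sub>0 'k) set" where
  "coset x = {f \<in> supp S. p f = p x}"

lemmas p_add = Modules.module_hom.add[OF linear]
  and p_diff = Modules.module_hom.diff[OF linear]
  and p_scale = Modules.module_hom.scale[OF linear]
  and p_zero = Modules.module_hom.zero[OF linear]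

lemma supp_A_S: "f \<in> supp A \<Longrightarrow> f \<in> supp S"
  using subset by (rule supp_mono[rotated])

lemma r_coset_eq:
  assumes "x \<in> supp S"
  shows "kernel +>\<^bsub>tree_space S\<^esub> x = coset x"
proof -
  have "f \<in> (\<lambda>h. h + x) ` kernel" if "f \<in> coset x" for f
    using that assms by (intro image_eqI[of _ _ "f - x"])
      (auto simp: kernel_def coset_def p_diff supp_diff)
  moreover have "h + x \<in> coset x" if "h \<in> kernel" for h
    using that assms by (simp add: kernel_def coset_def p_add supp_add)
  ultimately show ?thesis
    by (auto simp: a_r_coset_def')
qed

lemma coset_p: "x \<in> supp S \<Longrightarrow> coset (p x) = coset x"
  by (simp add: coset_def fixes_supp in_supp)

lemma carrier_quotient: "carrier quotient = coset ` supp A"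
proof -
  have "carrier quotient = coset ` supp S"
    by (auto simp: quotient_def quotient_module_def A_RCOSETS_def' r_coset_eq)
  also have "\<dots> = coset ` supp A"
  proof (intro equalityI image_subsetI)
    fix x :: "ptree \<Rightarrow>\<^sub>0 'k" assume "x \<in> supp S"
    then show "coset x \<in> coset ` supp A"
      by (subst coset_p[symmetric]) (auto intro: in_supp)
  qed (auto intro: supp_A_S)
  finally show ?thesis .
qed

lemma zero_quotient: "\<zero>\<^bsub>quotient\<^esub> = coset 0"
  by (simp add: quotient_def quotient_module_def kernel_def coset_def p_zero)

lemma add_quotient:
  assumes "x \<in> supp S" "y \<in> supp S"
  shows "coset x \<oplus>\<^bsub>quotient\<^esub> coset y = coset (x + y)"
proof -
  have "\<exists>g\<in>coset x. \<exists>h\<in>coset y. f = g + h" if "f \<in> coset (x + y)" for f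
    using that assms
    by (intro bexI[of _ x] bexI[of _ "f - x"]) (auto simp: coset_def p_diff p_add supp_diff)
  then show ?thesis
    by (auto simp: quotient_def quotient_module_def set_add_def' coset_def p_add supp_add)
qed

lemma coset_eq_iff:
  assumes "x \<in> supp S"
  shows "coset x = coset y \<longleftrightarrow> p x = p y"
  using assms by (auto simp: coset_def)

lemma smult_quotient:
  assumes "x \<in> supp S"
  shows "a \<odot>\<^bsub>quotient\<^esub> coset x = coset (scale a x)"
proof -
  have "kernel +>\<^bsub>tree_space S\<^esub> scale a f = coset (scale a x)" if "f \<in> coset x" for f
  proof -
    have "kernel +>\<^bsub>tree_space S\<^esub> scale a f = coset (scale a f)"
      using that by (intro r_coset_eq) (simp add: coset_def supp_scale)
    also have "\<dots> = coset (scale a x)"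
      using that by (simp add: coset_def p_scale)
    finally show ?thesis .
  qed
  moreover have "x \<in> coset x" using assms by (simp add: coset_def)
  ultimately show ?thesis by (auto simp: quotient_def quotient_module_def)
qed

lemma vectorspace_quotient: "vectorspace class_ring quotient"
proof (rule vs_criteria)
  show "\<forall>v\<in>carrier quotient. \<exists>w\<in>carrier quotient. v \<oplus>\<^bsub>quotient\<^esub> w = \<zero>\<^bsub>quotient\<^esub>"
  proof
    fix v assume "v \<in> carrier quotient"
    then obtain x where x: "v = coset x" "x \<in> supp A" by (auto simp: carrier_quotient)
    then have "v \<oplus>\<^bsub>quotient\<^esub> coset (- x) = \<zero>\<^bsub>quotient\<^esub>"
      by (simp add: add_quotient supp_A_S supp_neg zero_quotient)
    then show "\<exists>w\<in>carrier quotient. v \<oplus>\<^bsub>quotient\<^esub> w = \<zero>\<^bsub>quotient\<^esub>"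
      using x by (auto simp: carrier_quotient supp_neg)
  qed
qed (auto simp: carrier_quotient zero_quotient add_quotient smult_quotient supp_A_S
    supp_add supp_scale class_field add_ac
    pm.scale_left_distrib pm.scale_right_distrib)

lemma linear_map_coset: "linear_map class_ring (tree_space A) quotient coset"
proof -
  have "coset \<in> LinearCombinations.module_hom class_ring (tree_space A) quotient"
    by (auto simp: LinearCombinations.module_hom_def carrier_quotient add_quotient smult_quotient supp_A_S)
  then show ?thesis
    using vectorspace_tree_space[of A, where 'k = 'k] vectorspace_quotient
    by (simp add: linear_map_def mod_hom_def mod_hom_axioms_def vectorspace_def)
qed

lemma inj_on_coset: "inj_on coset (supp A)"
  by (rule inj_onI) (simp add: coset_eq_iff supp_A_S fixes_supp)

lemma bij_betw_coset: "bij_betw coset (carrier (tree_space A)) (carrier quotient)"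
  by (simp add: bij_betw_def inj_on_coset carrier_quotient)

lemma inj_on_coset_tree: "inj_on (\<lambda>t. coset (tree t)) A"
proof (rule inj_onI)
  fix s t assume "s \<in> A" "t \<in> A" "coset (tree s) = coset (tree t)"
  then have "(tree s :: ptree \<Rightarrow>\<^sub>0 'k) = tree t"
    using inj_on_coset by (auto simp: inj_on_def supp_single)
  then have "Poly_Mapping.keys (tree s :: ptree \<Rightarrow>\<^sub>0 'k) = Poly_Mapping.keys (tree t :: ptree \<Rightarrow>\<^sub>0 'k)"
    by (rule arg_cong)
  then show "s = t" by simp
qed

lemma lincomb_cosets:
  assumes "finite F" "F \<subseteq> A"
  shows "module.lincomb quotient a ((\<lambda>t. coset (tree t)) ` F)
    = coset (\<Sum>t\<in>F. Poly_Mapping.single t (a (coset (tree t))))"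
proof -
  interpret vectorspace class_ring quotient by (rule vectorspace_quotient)
  have in_quotient: "coset (tree t) \<in> carrier quotient" if "t \<in> A" for t
    using that by (simp add: carrier_quotient supp_single)
  show ?thesis
    using assms
  proof (induction F)
    case empty
    then show ?case by (simp add: lincomb_def zero_quotient)
  next
    case (insert t F)
    let ?C = "\<lambda>t. coset (tree t)"
    have notin: "?C t \<notin> ?C ` F"
      using insert inj_on_coset_tree by (auto simp: inj_on_def)
    have "lincomb a (?C ` insert t F) = a (?C t) \<odot>\<^bsub>quotient\<^esub> ?C t \<oplus>\<^bsub>quotient\<^esub> lincomb a (?C ` F)"
      unfolding lincomb_def image_insert using insert notin in_quotient
      by (subst finsum_insert) auto
    also have "\<dots> = coset (Poly_Mapping.single t (a (?C t)) + (\<Sum>t\<in>F. Poly_Mapping.single t (a (?C t))))"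
    proof -
      have "Poly_Mapping.single t r \<in> supp S" "(\<Sum>t\<in>F. Poly_Mapping.single t (a (?C t))) \<in> supp S" for r :: 'k
        using insert.prems subset by (auto intro!: supp_single supp_sum)
      then show ?thesis using insert by (simp add: smult_quotient add_quotient)
    qed
    finally show ?case using insert by simp
  qed
qed

lemma basis_cosets: "vectorspace.basis class_ring quotient ((\<lambda>t. coset (tree t)) ` A)"
proof -
  interpret vectorspace class_ring quotient by (rule vectorspace_quotient)
  let ?C = "\<lambda>t. coset (tree t)"
  have in_quotient: "?C ` A \<subseteq> carrier quotient"
    by (auto simp: carrier_quotient supp_single)
  have "lin_indpt (?C ` A)"
  proof
    assume "lin_dep (?C ` A)"
    then obtain V a v where V: "finite V" "V \<subseteq> ?C ` A" "lincomb a V = \<zero>\<^bsub>quotient\<^esub>" "v \<in> V" "a v \<noteq> 0"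
      unfolding lin_dep_def by auto
    then obtain F where F: "finite F" "F \<subseteq> A" "V = ?C ` F"
      by (metis finite_subset_image)
    let ?x = "\<Sum>t\<in>F. Poly_Mapping.single t (a (?C t))"
    have "coset ?x = coset 0"
      using V(3) F by (simp add: lincomb_cosets zero_quotient)
    moreover have "?x \<in> supp A"
      using F by (auto intro!: supp_sum supp_single)
    ultimately have "?x = 0"
      using inj_on_coset by (auto simp: inj_on_def)
    moreover obtain t where t: "t \<in> F" "v = ?C t"
      using V F by auto
    have "Poly_Mapping.lookup ?x t = a v"
      using F(1) t by (simp add: lookup_sum lookup_single when_def)
    ultimately show False using V(5) by simp
  qed
  moreover have "span (?C ` A) = carrier quotient"
  proof
    show "span (?C ` A) \<subseteq> carrier quotient"
      using in_quotient by (rule span_is_subset2)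
    show "carrier quotient \<subseteq> span (?C ` A)"
    proof
      fix v assume "v \<in> carrier quotient"
      then obtain x where x: "v = coset x" "x \<in> supp A" by (auto simp: carrier_quotient)
      let ?F = "Poly_Mapping.keys x" and ?a = "\<lambda>v. Poly_Mapping.lookup x (inv_into A ?C v)"
      have F: "?F \<subseteq> A" using x(2) by (simp add: supp_def)
      have "(\<Sum>t\<in>?F. Poly_Mapping.single t (?a (?C t))) = (\<Sum>t\<in>?F. Poly_Mapping.single t (Poly_Mapping.lookup x t))"
        using F by (intro sum.cong) (auto simp: inv_into_f_f[OF inj_on_coset_tree])
      also have "\<dots> = x"
        using lin_id[of x] by (simp add: lin_def del: lin_id)
      finally have "lincomb ?a (?C ` ?F) = v"
        using F x by (simp add: lincomb_cosets)
      then show "v \<in> span (?C ` A)"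
        unfolding span_def using F by (intro CollectI exI[of _ ?a] exI[of _ "?C ` ?F"]) auto
    qed
  qed
  ultimately show ?thesis
    unfolding basis_def using in_quotient by simp
qed

end

theorem proposition1p2:
  fixes m :: enat and n :: nat
  assumes "1 \<le> m" and "1 \<le> n"
  shows "vectorspace class_ring (A_operad m n :: ('k::field_char_0, (ptree \<Rightarrow>\<^sub>0 'k) set) module) \<and>
    inj_on (A_class m n :: ptree \<Rightarrow> (ptree \<Rightarrow>\<^sub>0 'k) set) (Adm m n) \<and>
    vectorspace.basis class_ring (A_operad m n :: ('k, (ptree \<Rightarrow>\<^sub>0 'k) set) module)
      (A_class m n ` Adm m n) \<and>
    (\<exists>\<phi>. linear_map class_ring (tree_space (Adm m n)) (A_operad m n) \<phi> \<and>
      bij_betw \<phi> (carrier (tree_space (Adm m n)))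
        (carrier (A_operad m n :: ('k, (ptree \<Rightarrow>\<^sub>0 'k) set) module)) \<and>
      (\<forall>t\<in>Adm m n. \<phi> (tree t) = A_class m n t))"
proof -
  interpret tree_projection "ntrees m n" "Adm m n" "normalize :: (ptree \<Rightarrow>\<^sub>0 'k) \<Rightarrow> _"
    by (rule tree_projection.intro)
      (auto intro: linear_normalize normalize_in_supp_Adm[OF assms(1)] normalize_Adm
        simp: Adm_iff ntrees_iff)
  have ideal: "A_ideal m n = kernel"
    unfolding kernel_def by (rule A_ideal_eq_kernel[OF assms])
  have quotient: "A_operad m n = quotient"
    unfolding A_operad_def quotient_def free_operad_def ideal ..
  have "A_class m n t = coset (tree t)" if "t \<in> Adm m n" for t
    unfolding A_class_def free_operad_def ideal
    using that by (intro r_coset_eq supp_A_S supp_single)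
  then have A_class: "inj_on (A_class m n :: ptree \<Rightarrow> (ptree \<Rightarrow>\<^sub>0 'k) set) (Adm m n)"
      "A_class m n ` Adm m n = (\<lambda>t. coset (tree t)) ` Adm m n"
      "\<forall>t\<in>Adm m n. coset (tree t) = A_class m n t"
    using inj_on_coset_tree by (simp_all cong: inj_on_cong)
  show ?thesis
    unfolding quotient
    using vectorspace_quotient A_class basis_cosets linear_map_coset bij_betw_coset by auto
qed

end
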